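(* Let $\{P_n\}_{n\ge0}$ be an $N\times N$ sequence of matrix-valued orthogonal polynomials (with respect to some weight matrix $W$), and for $j=1,\dots,M$ let $\{p_{j,n}\}_{n\ge0}$ be a $d_j\times d_j$ sequence of matrix-valued orthogonal polynomials (with respect to some weight matrix $w_j$), where $d_1+\cdots+d_M=N$. Then $\{P_n\}$ is a Darboux transformation of $\{p_{1,n}\oplus\cdots\oplus p_{M,n}\}$ if and only if, for each $j=1,\dots,M$, there exists an $N\times d_j$ matrix-valued linear differential operator $D_j$ satisfying $$\Lambda_n(D_j)\,p_{j,n}=P_n\cdot D_j\quad\text{for all } n\in\mathbb{N}_0,$$ for some $N\times d_j$ matrices $\Lambda_n(D_j)$ with complex entries, and the $N\times N$ matrix $$\begin{pmatrix}\Lambda_n(D_1)&\Lambda_n(D_2)&\cdots&\Lambda_n(D_M)\end{pmatrix}$$ obtained by placing the blocks $\Lambda_n(D_j)$ side by side is invertible for some $n$.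
   Context: Fix a possibly infinite interval $(x_0,x_1)$ of the real line. A weight matrix of size $N$ is a complex $N\times N$ matrix-valued smooth function $W$ on $(x_0,x_1)$ that is positive definite almost everywhere and has finite moments of all orders. For $P,Q\in\operatorname{Mat}_N(\mathbb{C}[x])$ put $\langle P,Q\rangle_W=\int_{x_0}^{x_1}P(x)W(x)Q(x)^*\,dx$, where $*$ is the Hermitian conjugate. A sequence of matrix-valued orthogonal polynomials with respect to $W$ is a sequence $\{P_n\}_{n\in\mathbb{N}_0}$ in $\operatorname{Mat}_N(\mathbb{C}[x])$, $\mathbb{N}_0=\{0,1,\dots\}$, with $P_n$ of degree $n$ with nonsingular leading coefficient and $\langle P_n,P_m\rangle_W=0$ for $n\ne m$. The direct sum $F_1\oplus\cdots\oplus F_r$ is the block diagonal matrix with blocks $F_1,\dots,F_r$. Differential operators $D=\sum_{i=0}^s\partial^iF_i(x)$, $\partial=\frac{d}{dx}$, act on the right: $(P\cdot D)(x)=\sum_{i=0}^s\frac{d^iP}{dx^i}(x)F_i(x)$, and $P\cdot(DE)=(P\cdot D)\cdot E$. All differential operators (square or rectangular) have coefficients $F_i$ with entries in $\mathbb{C}[x]$. $\operatorname{Mat}_N(\Omega[x])$ is the algebra of $N\times N$ such operators. $\mathcal{D}(W)$ is the set of $D\in\operatorname{Mat}_N(\Omega[x])$ such that, for every $n\in\mathbb{N}_0$, $P_n\cdot D=\Lambda_n(D)P_n$ for some $\Lambda_n(D)\in\operatorname{Mat}_N(\mathbb{C})$ (this does not depend on the chosen orthogonal sequence $\{P_n\}$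 for $W$). An operator $E\in\operatorname{Mat}_N(\Omega[x])$ is degree-preserving if, for all but finitely many $n\in\mathbb{N}_0$, for any (matrix) polynomial $f$ of degree $n$ the function $f\cdot E$ is again a polynomial of degree $n$. For sequences $\{P_n\},\{\tilde P_n\}$ of $N\times N$ matrix-valued orthogonal polynomials with respect to $W,\tilde W$, $\{\tilde P_n\}$ is a Darboux transformation of $\{P_n\}$ if there is $D\in\mathcal{D}(W)$ that can be factorized as $D=\mathcal{V}\mathcal{N}$ with degree-preserving $\mathcal{V},\mathcal{N}\in\operatorname{Mat}_N(\Omega[x])$ such that $P_n\cdot\mathcal{V}=A_n\tilde P_n$ for all $n\in\mathbb{N}_0$, for some $A_n\in\operatorname{Mat}_N(\mathbb{C})$. For $D=\sum_j\partial^jF_j$ let $D^*=\sum_jF_j(x)^*(-1)^j\partial^j$ be the formal adjoint; thus $Q\cdot(WD^*W^{-1})=\sum_j(-1)^j\frac{d^j}{dx^j}(QWF_j^* )W^{-1}$. Standing assumption on weights: all weight matrices considered (including direct sums of the weights considered) are "good enough" in the following sense, written for a weight $W$ of size $N$: if $D\in\operatorname{Mat}_N(\Omega[x])$ and $A\in\operatorname{Mat}_N(\mathbb{C}[x])$ satisfy $\int_{x_0}^{x_1}PAW\,dx=\int_{x_0}^{x_1}P\,(W\cdot D)\,dx$ for all $P\in\operatorname{Mat}_N(\mathbb{C}[x])$, then $AW=W\cdot D$. In particular, whenever $D,\tilde D\in\operatorname{Mat}_N(\Omega[x])$ satisfy $\langle P\cdot D,Q\rangle_W=\langle P,Q\cdot\tilde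 D\rangle_W$ for all $P,Q\in\operatorname{Mat}_N(\mathbb{C}[x])$, one has $\tilde D=WD^*W^{-1}$. *)

theory Defs
  imports
    "HOL-Analysis.Interval_Integral"
    "HOL-Library.Infinite_Set"
    "Jordan_Normal_Form.Schur_Decomposition"
begin

hide_const (open) Finite_Cartesian_Product.mat Finite_Cartesian_Product.vec
hide_type (open) Finite_Cartesian_Product.vec

text \<open>
  An operator \<open>\<Sum>\<^sub>i \<partial>\<^sup>i f\<^sub>i\<close> (coefficients to the right of \<open>\<partial>\<close>, acting from the right) is stored
  as the polynomial in \<open>\<partial>\<close> whose \<open>i\<close>-th coefficient is \<open>f\<^sub>i\<close>.  It gets its own type because
  its product is not the commutative product of \<^typ>\<open>complex poly poly\<close>.
\<close>

datatype weyl = Weyl (weyl_poly: "complex poly poly")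

definition dop_coeff :: "weyl \<Rightarrow> nat \<Rightarrow> complex poly" where
  "dop_coeff D i = coeff (weyl_poly D) i"

definition dop_order :: "weyl \<Rightarrow> nat" where
  "dop_order D = degree (weyl_poly D)"

definition dop_act :: "complex poly \<Rightarrow> weyl \<Rightarrow> complex poly" where
  "dop_act p D = (\<Sum>i\<le>dop_order D. (pderiv ^^ i) p * dop_coeff D i)"

text \<open>Right multiplication by \<open>\<partial>\<close>: since \<open>(p f)' = p' f + p f'\<close>, one has
  \<open>f \<partial> = \<partial> f + f'\<close> for the right action.\<close>

definition times_dx :: "complex poly poly \<Rightarrow> complex poly poly" where
  "times_dx q = pCons 0 q + map_poly pderiv q"

instantiation weyl :: "{zero, one, plus, minus, uminus, times}"
begin

definition zero_weyl :: weyl where "0 = Weyl 0"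
definition one_weyl :: weyl where "1 = Weyl 1"
definition plus_weyl :: "weyl \<Rightarrow> weyl \<Rightarrow> weyl" where
  "D + E = Weyl (weyl_poly D + weyl_poly E)"
definition minus_weyl :: "weyl \<Rightarrow> weyl \<Rightarrow> weyl" where
  "D - E = Weyl (weyl_poly D - weyl_poly E)"
definition uminus_weyl :: "weyl \<Rightarrow> weyl" where
  "- D = Weyl (- weyl_poly D)"

text \<open>\<open>D (\<Sum>\<^sub>j \<partial>\<^sup>j g\<^sub>j) = \<Sum>\<^sub>j (D \<partial>\<^sup>j) g\<^sub>j\<close>; the law \<open>dop_act_mult\<close> below is the defining
  property \<open>P \<cdot> (D E) = (P \<cdot> D) \<cdot> E\<close>.\<close>

definition times_weyl :: "weyl \<Rightarrow> weyl \<Rightarrow> weyl" where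
  "D * E = Weyl (\<Sum>j\<le>dop_order E. smult (dop_coeff E j) ((times_dx ^^ j) (weyl_poly D)))"

instance ..

end

definition raw_act :: "complex poly \<Rightarrow> complex poly poly \<Rightarrow> complex poly" where
  "raw_act p q = (\<Sum>i\<le>degree q. (pderiv ^^ i) p * coeff q i)"

lemma dop_act_raw: "dop_act p D = raw_act p (weyl_poly D)"
  by (simp add: dop_act_def raw_act_def dop_order_def dop_coeff_def)

lemma raw_act_bound:
  assumes "degree q \<le> n"
  shows "raw_act p q = (\<Sum>i\<le>n. (pderiv ^^ i) p * coeff q i)"
  unfolding raw_act_def
  by (rule sum.mono_neutral_left) (use assms in \<open>auto simp: coeff_eq_0\<close>)

lemma raw_act_add_left: "raw_act (p + p') q = raw_act p q + raw_act p' q"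
  by (simp add: raw_act_def higher_pderiv_add algebra_simps sum.distrib)

lemma raw_act_0_left [simp]: "raw_act 0 q = 0"
  by (simp add: raw_act_def)

lemma raw_act_0 [simp]: "raw_act p 0 = 0"
  by (simp add: raw_act_def)

lemma raw_act_1 [simp]: "raw_act p 1 = p"
  by (simp add: raw_act_def)

lemma raw_act_add: "raw_act p (q + r) = raw_act p q + raw_act p r"
proof -
  define n where "n = max (degree q) (degree r)"
  have "degree (q + r) \<le> n" "degree q \<le> n" "degree r \<le> n"
    by (auto simp: n_def degree_add_le_max)
  then show ?thesis
    by (simp add: raw_act_bound[of _ n] algebra_simps sum.distrib)
qed

lemma raw_act_minus: "raw_act p (- q) = - raw_act p q"
  by (simp add: raw_act_def sum_negf)

lemma raw_act_smult: "raw_act p (smult g q) = raw_act p q * g"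
proof -
  have "degree (smult g q) \<le> degree q" by (rule degree_smult_le)
  then show ?thesis
    by (simp add: raw_act_bound[of _ "degree q"] sum_distrib_left sum_distrib_right algebra_simps)
qed

lemma raw_act_sum: "raw_act p (\<Sum>i\<in>A. f i) = (\<Sum>i\<in>A. raw_act p (f i))"
  by (induction A rule: infinite_finite_induct) (auto simp: raw_act_add)

lemma pderiv_sum_complex: "pderiv (\<Sum>i\<in>A. f i) = (\<Sum>i\<in>A. pderiv (f i))"
  for f :: "_ \<Rightarrow> complex poly"
  by (induction A rule: infinite_finite_induct) (auto simp: pderiv_add)

lemma raw_act_times_dx: "raw_act p (times_dx q) = pderiv (raw_act p q)"
proof -
  have 1: "raw_act p (pCons 0 q) = (\<Sum>i\<le>degree q. (pderiv ^^ Suc i) p * coeff q i)"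
  proof -
    have "raw_act p (pCons 0 q) = (\<Sum>i\<le>Suc (degree q). (pderiv ^^ i) p * coeff (pCons 0 q) i)"
      by (rule raw_act_bound) (simp add: degree_pCons_le)
    also have "\<dots> = (\<Sum>i\<le>degree q. (pderiv ^^ Suc i) p * coeff q i)"
      by (subst sum.atMost_Suc_shift) simp
    finally show ?thesis .
  qed
  have 2: "raw_act p (map_poly pderiv q) = (\<Sum>i\<le>degree q. (pderiv ^^ i) p * pderiv (coeff q i))"
    by (subst raw_act_bound[of _ "degree q"]) (auto simp: degree_map_poly_le coeff_map_poly)
  have "pderiv (raw_act p q)
      = (\<Sum>i\<le>degree q. (pderiv ^^ Suc i) p * coeff q i + (pderiv ^^ i) p * pderiv (coeff q i))"
    unfolding raw_act_def pderiv_sum_complex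
    by (intro sum.cong) (auto simp: pderiv_mult algebra_simps)
  then show ?thesis
    unfolding times_dx_def raw_act_add 1 2 by (simp add: sum.distrib)
qed

lemma raw_act_times_dx_funpow: "raw_act p ((times_dx ^^ j) q) = (pderiv ^^ j) (raw_act p q)"
  by (induction j) (auto simp: raw_act_times_dx)

lemma dop_act_mult: "dop_act p (D * E) = dop_act (dop_act p D) E"
  unfolding dop_act_raw times_weyl_def
  by (simp add: raw_act_sum raw_act_smult raw_act_times_dx_funpow)
     (simp add: raw_act_def dop_order_def dop_coeff_def)

lemma higher_pderiv_monom_self: "(pderiv ^^ n) (monom 1 n) = [:fact n :: complex:]"
  by (rule poly_eqI)
     (simp add: coeff_higher_pderiv pochhammer_fact[symmetric] coeff_pCons split: nat.split)

lemma higher_pderiv_monom_above: "n < i \<Longrightarrow> (pderiv ^^ i) (monom (1::complex) n) = 0"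
  by (rule poly_eqI) (simp add: coeff_higher_pderiv)

lemma raw_act_inj:
  assumes "\<And>p. raw_act p q = 0"
  shows "q = 0"
proof (rule ccontr)
  assume "q \<noteq> 0"
  then have ex: "\<exists>i. coeff q i \<noteq> 0"
    by (auto simp: poly_eq_iff)
  define m where "m = (LEAST i. coeff q i \<noteq> 0)"
  have m: "coeff q m \<noteq> 0"
    unfolding m_def using ex by (rule LeastI_ex)
  have small: "coeff q i = 0" if "i < m" for i
    using not_less_Least[OF that[unfolded m_def]] by simp
  have "m \<le> degree q"
    using m by (rule le_degree)
  have "raw_act (monom 1 m) q = (\<Sum>i\<le>degree q. if i = m then [:fact m:] * coeff q m else 0)"
    unfolding raw_act_def
  proof (intro sum.cong refl)
    fix i
    show "(pderiv ^^ i) (monom 1 m) * coeff q i = (if i = m then [:fact m:] * coeff q m else 0)"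
      by (cases i m rule: linorder_cases)
         (simp_all add: higher_pderiv_monom_self higher_pderiv_monom_above small)
  qed
  also have "\<dots> = [:fact m:] * coeff q m"
    using \<open>m \<le> degree q\<close> by simp
  also have "\<dots> \<noteq> 0"
    using m by simp
  finally show False
    using assms by simp
qed

lemma weyl_eqI:
  assumes "\<And>p. dop_act p D = dop_act p E"
  shows "D = E"
proof -
  have "raw_act p (weyl_poly D + - weyl_poly E) = 0" for p
    unfolding raw_act_add raw_act_minus using assms[of p] unfolding dop_act_raw by simp
  then have "weyl_poly D + - weyl_poly E = 0"
    by (rule raw_act_inj)
  then have "weyl_poly D = weyl_poly E"
    unfolding eq_neg_iff_add_eq_0[symmetric] minus_minus .
  then show ?thesis
    by (rule weyl.expand)
qed

lemma dop_act_simps [simp]: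
  "dop_act 0 D = 0" "dop_act p 0 = 0" "dop_act p 1 = p"
  "dop_act (p + p') D = dop_act p D + dop_act p' D"
  "dop_act p (D + E) = dop_act p D + dop_act p E"
  "dop_act p (- D) = - dop_act p D"
  by (simp_all add: dop_act_raw zero_weyl_def one_weyl_def plus_weyl_def uminus_weyl_def
      raw_act_add raw_act_add_left raw_act_minus)

instance weyl :: ring_1
proof
  fix a b c :: weyl
  show "a + b + c = a + (b + c)" "a + b = b + a"
    by (rule weyl_eqI; simp add: algebra_simps)+
  show "0 + a = a" "- a + a = 0"
    by (rule weyl_eqI; simp)+
  show "a - b = a + - b"
    by (simp add: minus_weyl_def plus_weyl_def uminus_weyl_def)
  show "a * b * c = a * (b * c)" "(a + b) * c = a * c + b * c" "a * (b + c) = a * b + a * c"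
    "1 * a = a" "a * 1 = a"
    by (rule weyl_eqI; simp add: dop_act_mult)+
  show "(0::weyl) \<noteq> 1"
    by (simp add: zero_weyl_def one_weyl_def)
qed

text \<open>\<open>Mat\<^sub>N(\<Omega>[x])\<close> is \<open>carrier_mat N N :: weyl mat set\<close>, with the library's matrix product.\<close>

definition mat_act :: "complex poly mat \<Rightarrow> weyl mat \<Rightarrow> complex poly mat" where
  "mat_act P D = mat (dim_row P) (dim_col D)
     (\<lambda>(i, j). \<Sum>k<dim_row D. dop_act (P $$ (i, k)) (D $$ (k, j)))"

lemma dop_act_sum_left: "dop_act (\<Sum>i\<in>A. f i) D = (\<Sum>i\<in>A. dop_act (f i) D)"
  by (induction A rule: infinite_finite_induct) auto

lemma dop_act_sum_right: "dop_act p (\<Sum>i\<in>A. f i) = (\<Sum>i\<in>A. dop_act p (f i))"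
  by (induction A rule: infinite_finite_induct) auto

lemma mat_act_mult:
  assumes "P \<in> carrier_mat k n" "D \<in> carrier_mat n m" "E \<in> carrier_mat m l"
  shows "mat_act P (D * E) = mat_act (mat_act P D) E"
proof (rule eq_matI)
  fix i j
  assume "i < dim_row (mat_act (mat_act P D) E)" "j < dim_col (mat_act (mat_act P D) E)"
  then have ij: "i < k" "j < l"
    using assms by (auto simp: mat_act_def)
  have "mat_act P (D * E) $$ (i, j)
      = (\<Sum>a<n. \<Sum>b<m. dop_act (dop_act (P $$ (i, a)) (D $$ (a, b))) (E $$ (b, j)))"
    using assms ij
    by (auto simp: mat_act_def scalar_prod_def dop_act_sum_right dop_act_mult lessThan_atLeast0
        intro!: sum.cong)
  also have "\<dots> = (\<Sum>b<m. \<Sum>a<n. dop_act (dop_act (P $$ (i, a)) (D $$ (a, b))) (E $$ (b, j)))"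
    by (rule sum.swap)
  also have "\<dots> = mat_act (mat_act P D) E $$ (i, j)"
    using assms ij by (auto simp: mat_act_def dop_act_sum_left intro!: sum.cong)
  finally show "mat_act P (D * E) $$ (i, j) = mat_act (mat_act P D) E $$ (i, j)" .
qed (use assms in \<open>auto simp: mat_act_def\<close>)

definition const_mat :: "complex mat \<Rightarrow> complex poly mat" where
  "const_mat A = map_mat (\<lambda>c. [:c:]) A"

definition eval_mat :: "complex poly mat \<Rightarrow> real \<Rightarrow> complex mat" where
  "eval_mat P x = map_mat (\<lambda>p. poly p (of_real x)) P"

text \<open>As for \<^const>\<open>degree\<close>, the zero matrix gets degree \<open>0\<close>.\<close>

definition mat_degree :: "complex poly mat \<Rightarrow> nat" where
  "mat_degree P = Max (insert 0 (degree ` elements_mat P))"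

definition lead_coeff_mat :: "complex poly mat \<Rightarrow> complex mat" where
  "lead_coeff_mat P = map_mat (\<lambda>p. coeff p (mat_degree P)) P"

definition degree_preserving :: "nat \<Rightarrow> weyl mat \<Rightarrow> bool" where
  "degree_preserving N E \<longleftrightarrow>
     (\<forall>\<^sub>\<infinity>n. \<forall>f\<in>carrier_mat N N. mat_degree f = n \<longrightarrow> mat_degree (mat_act f E) = n)"

definition mat_direct_sum :: "nat \<Rightarrow> (nat \<Rightarrow> 'a::zero mat) \<Rightarrow> 'a mat" where
  "mat_direct_sum M F = diag_block_mat (map F [1..<Suc M])"

definition side_by_side :: "nat \<Rightarrow> nat \<Rightarrow> (nat \<Rightarrow> 'a mat) \<Rightarrow> 'a mat" where
  "side_by_side N M F = mat_of_cols N (concat (map (\<lambda>j. cols (F j)) [1..<Suc M]))"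

definition nth_vderiv :: "nat \<Rightarrow> (real \<Rightarrow> complex) \<Rightarrow> real \<Rightarrow> complex" where
  "nth_vderiv m = (\<lambda>f x. vector_derivative f (at x)) ^^ m"

definition smooth_on_set :: "real set \<Rightarrow> (real \<Rightarrow> complex) \<Rightarrow> bool" where
  "smooth_on_set S f \<longleftrightarrow> (\<forall>m. \<forall>x\<in>S. nth_vderiv m f differentiable (at x))"

definition pos_def_mat :: "nat \<Rightarrow> complex mat \<Rightarrow> bool" where
  "pos_def_mat N A \<longleftrightarrow> A \<in> carrier_mat N N \<and> mat_adjoint A = A \<and>
     (\<forall>v\<in>carrier_vec N. v \<noteq> 0\<^sub>v N \<longrightarrow> 0 < Re ((A *\<^sub>v v) \<bullet>c v))"

text \<open>Only the values of \<open>W\<close> on the interval matter.\<close>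

definition weight_matrix :: "ereal \<Rightarrow> ereal \<Rightarrow> nat \<Rightarrow> (real \<Rightarrow> complex mat) \<Rightarrow> bool" where
  "weight_matrix x0 x1 N W \<longleftrightarrow>
     N > 0 \<and>
     (\<forall>x\<in>einterval x0 x1. W x \<in> carrier_mat N N) \<and>
     (\<forall>i<N. \<forall>j<N. smooth_on_set (einterval x0 x1) (\<lambda>x. W x $$ (i, j))) \<and>
     (AE x in lborel. x \<in> einterval x0 x1 \<longrightarrow> pos_def_mat N (W x)) \<and>
     (\<forall>n. \<forall>i<N. \<forall>j<N.
        set_integrable lborel (einterval x0 x1) (\<lambda>x. of_real (x ^ n) * W x $$ (i, j)))"

definition mat_integrable ::
    "ereal \<Rightarrow> ereal \<Rightarrow> nat \<Rightarrow> (real \<Rightarrow> complex mat) \<Rightarrow> bool" where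
  "mat_integrable x0 x1 N F \<longleftrightarrow>
     (\<forall>i<N. \<forall>j<N. set_integrable lborel (einterval x0 x1) (\<lambda>x. F x $$ (i, j)))"

definition mat_integral ::
    "ereal \<Rightarrow> ereal \<Rightarrow> nat \<Rightarrow> (real \<Rightarrow> complex mat) \<Rightarrow> complex mat" where
  "mat_integral x0 x1 N F =
     mat N N (\<lambda>(i, j). LINT x:einterval x0 x1|lborel. F x $$ (i, j))"

definition mat_inner ::
    "ereal \<Rightarrow> ereal \<Rightarrow> nat \<Rightarrow> (real \<Rightarrow> complex mat) \<Rightarrow>
     complex poly mat \<Rightarrow> complex poly mat \<Rightarrow> complex mat" where
  "mat_inner x0 x1 N W P Q =
     mat_integral x0 x1 N (\<lambda>x. eval_mat P x * W x * mat_adjoint (eval_mat Q x))"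

text \<open>The same right action, on a (smooth) matrix-valued function:
  \<open>(W \<cdot> D)(x) = \<Sum>\<^sub>m W\<^bsup>(m)\<^esup>(x) F\<^sub>m(x)\<close>.\<close>

definition fun_act :: "(real \<Rightarrow> complex mat) \<Rightarrow> weyl mat \<Rightarrow> real \<Rightarrow> complex mat" where
  "fun_act W D x = mat (dim_row (W x)) (dim_col D)
     (\<lambda>(i, j). \<Sum>k<dim_row D. \<Sum>m\<le>dop_order (D $$ (k, j)).
        nth_vderiv m (\<lambda>t. W t $$ (i, k)) x * poly (dop_coeff (D $$ (k, j)) m) (of_real x))"

text \<open>The equality of integrals presupposes that the right-hand integrals exist; this has to be
  said explicitly because the Bochner integral of a non-integrable function is \<open>0\<close>.  (The left-hand
  ones exist because \<open>W\<close> has finite moments.)\<close>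

definition good_weight :: "ereal \<Rightarrow> ereal \<Rightarrow> nat \<Rightarrow> (real \<Rightarrow> complex mat) \<Rightarrow> bool" where
  "good_weight x0 x1 N W \<longleftrightarrow>
     (\<forall>D\<in>carrier_mat N N. \<forall>A\<in>carrier_mat N N.
        (\<forall>P\<in>carrier_mat N N.
           mat_integrable x0 x1 N (\<lambda>x. eval_mat P x * fun_act W D x) \<and>
           mat_integral x0 x1 N (\<lambda>x. eval_mat P x * eval_mat A x * W x) =
           mat_integral x0 x1 N (\<lambda>x. eval_mat P x * fun_act W D x))
        \<longrightarrow> (\<forall>x\<in>einterval x0 x1. eval_mat A x * W x = fun_act W D x))"

definition orthogonal_polys ::
    "ereal \<Rightarrow> ereal \<Rightarrow> nat \<Rightarrow> (real \<Rightarrow> complex mat) \<Rightarrow> (nat \<Rightarrow> complex poly mat) \<Rightarrow> bool" where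
  "orthogonal_polys x0 x1 N W P \<longleftrightarrow>
     (\<forall>n. P n \<in> carrier_mat N N \<and> mat_degree (P n) = n \<and> invertible_mat (lead_coeff_mat (P n))) \<and>
     (\<forall>n m. n \<noteq> m \<longrightarrow> mat_inner x0 x1 N W (P n) (P m) = 0\<^sub>m N N)"

definition op_algebra ::
    "ereal \<Rightarrow> ereal \<Rightarrow> nat \<Rightarrow> (real \<Rightarrow> complex mat) \<Rightarrow> weyl mat set" where
  "op_algebra x0 x1 N W = {D \<in> carrier_mat N N.
     \<forall>P. orthogonal_polys x0 x1 N W P \<longrightarrow>
       (\<forall>n. \<exists>\<Lambda>\<in>carrier_mat N N. mat_act (P n) D = const_mat \<Lambda> * P n)}"

text \<open>\<open>P'\<close> is a Darboux transformation of \<open>P\<close>, where \<open>P\<close> is orthogonal with respect to \<open>W\<close>.\<close>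

definition darboux_transformation ::
    "ereal \<Rightarrow> ereal \<Rightarrow> nat \<Rightarrow> (real \<Rightarrow> complex mat) \<Rightarrow>
     (nat \<Rightarrow> complex poly mat) \<Rightarrow> (nat \<Rightarrow> complex poly mat) \<Rightarrow> bool" where
  "darboux_transformation x0 x1 N W P P' \<longleftrightarrow>
     (\<exists>D\<in>op_algebra x0 x1 N W. \<exists>\<V>\<in>carrier_mat N N. \<exists>\<N>\<in>carrier_mat N N.
        D = \<V> * \<N> \<and> degree_preserving N \<V> \<and> degree_preserving N \<N> \<and>
        (\<forall>n. \<exists>A\<in>carrier_mat N N. mat_act (P n) \<V> = const_mat A * P' n))"

end

theory Submission
  imports Defs
begin

text \<open>
  Suppose \<open>P\<^sub>n \<cdot> D = \<Gamma>\<^sub>n Q\<^sub>n\<close> for all \<open>n\<close>, where \<open>P\<^sub>n\<close> and \<open>Q\<^sub>n\<close> are orthogonal for two weights.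
  The point is that \<open>D\<close> has an adjoint \<open>V\<close> that is again a differential operator with polynomial
  coefficients.  As a linear map it exists by Riesz representation, since for a fixed polynomial
  \<open>v\<close> the functional \<open>u \<mapsto> \<langle>u \<cdot> D, v\<rangle>\<close> vanishes on the rows of \<open>P\<^sub>n\<close> for large \<open>n\<close>.  Multiplication
  by \<open>x\<close> is symmetric for both forms, so the iterated commutators of \<open>x\<close> with \<open>V\<close> are, up to sign,
  adjoint to those of \<open>x\<close> with \<open>D\<close>; the latter vanish eventually, and a linear map with this
  property is a differential operator.  By orthogonality \<open>Q\<^sub>n \<cdot> V = A\<^sub>n P\<^sub>n\<close>, and \<open>A\<^sub>n\<close> is invertible
  whenever \<open>\<Gamma>\<^sub>n\<close> is.

  For a Darboux transformation, the blocks of columns of the adjoint of \<open>\<V>\<close> are the \<open>D\<^sub>j\<close>.  Conversely,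
  take \<open>\<N> = (D\<^sub>1 \<dots> D\<^sub>M)\<close> and let \<open>\<V>\<close> be its adjoint.  Both preserve degrees for almost all \<open>n\<close>: the
  leading coefficient of \<open>f \<cdot> \<N>\<close> is that of \<open>f\<close> times a matrix that is polynomial in \<open>n\<close>, and the
  determinant of this matrix is nonzero where \<open>\<Gamma>\<^sub>n\<close> is invertible.
\<close>

section \<open>Differential operators and linear algebra\<close>

text \<open>Leibniz rule for the factor x, whose second derivative is 0. For \<open>i = 0\<close>
  the truncated \<open>i - 1\<close> does no harm, since its term carries the factor
  \<open>of_nat i\<close>.\<close>

lemma higher_pderiv_X_mult:
  "(pderiv ^^ i) ([:0, 1:] * p) = [:0, 1:] * (pderiv ^^ i) p + of_nat i * (pderiv ^^ (i - 1)) p"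
  for p :: "complex poly"
proof (induction i)
  case (Suc i)
  have "of_nat i * pderiv ((pderiv ^^ (i - 1)) p) = of_nat i * (pderiv ^^ i) p"
    by (cases i) simp_all
  moreover have "pderiv ([:0, 1:] * r) = r + [:0, 1:] * pderiv r" for r :: "complex poly"
    by (simp add: pderiv_pCons)
  moreover have "(pderiv ^^ Suc i) ([:0, 1:] * p) = pderiv ((pderiv ^^ i) ([:0, 1:] * p))"
    by simp
  moreover have "pderiv (of_nat i * r) = of_nat i * pderiv r" for r :: "complex poly"
    by (simp add: pderiv_mult)
  ultimately show ?case
    by (simp only: Suc.IH pderiv_add) (simp add: algebra_simps del: mult_pCons_left mult_pCons_right)
qed simp

text \<open>On the right, \<^const>\<open>pderiv\<close> differentiates formally with respect to \<open>\<partial>\<close>.\<close>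

lemma raw_act_X_mult:
  "raw_act ([:0, 1:] * p) q - [:0, 1:] * raw_act p q = raw_act p (pderiv q)"
proof -
  have "raw_act ([:0, 1:] * p) q - [:0, 1:] * raw_act p q
      = (\<Sum>i\<le>degree q. of_nat i * (pderiv ^^ (i - 1)) p * coeff q i)"
    unfolding raw_act_def higher_pderiv_X_mult sum_distrib_left
    by (simp add: sum_subtractf[symmetric] algebra_simps del: mult_pCons_left mult_pCons_right)
  also have "\<dots> = (\<Sum>i\<le>Suc (degree q). of_nat i * (pderiv ^^ (i - 1)) p * coeff q i)"
    by (simp add: coeff_eq_0)
  also have "\<dots> = (\<Sum>i\<le>degree q. (pderiv ^^ i) p * (of_nat (Suc i) * coeff q (Suc i)))"
    by (subst sum.atMost_Suc_shift) (simp add: algebra_simps)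
  also have "\<dots> = raw_act p (pderiv q)"
    by (subst raw_act_bound[of _ "degree q"]) (simp_all add: degree_pderiv coeff_pderiv del: of_nat_Suc)
  finally show ?thesis .
qed

lemma raw_act_smult_left: "raw_act (smult c p) q = smult c (raw_act p q)"
  by (simp add: raw_act_def higher_pderiv_smult smult_sum2)

lemma raw_act_sum_left: "raw_act (\<Sum>i\<in>A. f i) q = (\<Sum>i\<in>A. raw_act (f i) q)"
  by (induction A rule: infinite_finite_induct) (auto simp: raw_act_add_left)

lemma higher_pderiv_eq_0: "degree q < s \<Longrightarrow> (pderiv ^^ s) q = 0"
  for q :: "complex poly poly"
  by (rule poly_eqI) (simp add: coeff_higher_pderiv coeff_eq_0)

text \<open>Coefficientwise integration in \<partial>, possible in characteristic 0. With the
  commutator formula above it shows that every operator with polynomial coefficients is a commutator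
  with x.\<close>

lemma pderiv_surj: "\<exists>r. pderiv r = q"
  for q :: "complex poly poly"
proof -
  define r where "r = (\<Sum>i\<le>degree q. monom (smult (1 / of_nat (Suc i)) (coeff q i)) (Suc i))"
  have "pderiv r = (\<Sum>i\<le>degree q. monom (coeff q i) i)"
  proof -
    have "pderiv r = (\<Sum>i\<le>degree q. pderiv (monom (smult (1 / of_nat (Suc i)) (coeff q i)) (Suc i)))"
      unfolding r_def by (rule higher_pderiv_sum[of 1, simplified])
    also have "\<dots> = (\<Sum>i\<le>degree q. monom (coeff q i) i)"
      by (intro sum.cong refl) (simp add: pderiv_monom of_nat_poly del: of_nat_Suc)
    finally show ?thesis .
  qed
  then show ?thesis
    using poly_as_sum_of_monoms[of q] by metis
qed

section \<open>Differential operators characterised by iterated commutators with x\<close>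

definition ad_X :: "(complex poly \<Rightarrow> complex poly) \<Rightarrow> complex poly \<Rightarrow> complex poly" where
  "ad_X T p = T ([:0, 1:] * p) - [:0, 1:] * T p"

text \<open>Induction on \<open>s\<close>: the commutator of \<open>T\<close> with x is a
  differential operator \<open>q\<close>. An antiderivative of \<open>q\<close> in \<partial> has
  the same commutator, so it differs from \<open>T\<close> by a map that commutes with x. Such a map
  is multiplication by its value at 1, which the term of order 0 absorbs.\<close>

lemma ad_X_nilpotent_imp_raw_act:
  assumes "\<And>p q. T (p + q) = T p + T q" "\<And>c p. T (smult c p) = smult c (T p)"
    and "\<And>p. (ad_X ^^ s) T p = 0"
  shows "\<exists>q. \<forall>p. T p = raw_act p q"
  using assms
proof (induction s arbitrary: T)
  case 0
  then show ?case by (intro exI[of _ 0]) simp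
next
  case (Suc s)
  have "\<exists>q. \<forall>p. ad_X T p = raw_act p q"
  proof (rule Suc.IH)
    show "ad_X T (p + q) = ad_X T p + ad_X T q" for p q
      by (simp add: ad_X_def Suc.prems distrib_left del: mult_pCons_left mult_pCons_right)
    show "ad_X T (smult c p) = smult c (ad_X T p)" for c p
      by (simp add: ad_X_def Suc.prems smult_diff_right del: mult_pCons_left mult_pCons_right)
    show "(ad_X ^^ s) (ad_X T) p = 0" for p
      using Suc.prems(3)[of p] by (simp add: funpow_swap1)
  qed
  then obtain q where q: "\<And>p. ad_X T p = raw_act p q" by blast
  obtain r0 where r0: "pderiv r0 = q" using pderiv_surj by blast
  \<comment> \<open>The term of order 0 is lost under \<open>pderiv\<close> and hence free; this
    choice makes \<open>r\<close> send 1 to \<open>T 1\<close>.\<close>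
  define r where "r = r0 + [:T 1 - coeff r0 0:]"
  have r: "pderiv r = q" "coeff r 0 = T 1"
    by (simp_all add: r_def r0 pderiv_add)
  define S where "S p = T p - raw_act p r" for p
  have S_X: "S ([:0, 1:] * p) = [:0, 1:] * S p" for p
    using q[of p] raw_act_X_mult[of p r]
    by (simp add: S_def ad_X_def r algebra_simps del: mult_pCons_left mult_pCons_right)
  have S_add: "S (p + q) = S p + S q" and S_smult: "S (smult c p) = smult c (S p)" for p q c
    by (simp_all add: S_def Suc.prems raw_act_add_left raw_act_smult_left smult_diff_right)
  have "raw_act 1 r = coeff r 0"
  proof -
    have "(pderiv ^^ i) (1 :: complex poly) = (if i = 0 then 1 else 0)" for i
      by (induction i) auto
    then show ?thesis
      by (simp add: raw_act_def if_distrib[of "\<lambda>x. x * _"] cong: if_cong)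
  qed
  then have S_1: "S 1 = 0" by (simp add: S_def r)
  \<comment> \<open>\<open>S\<close> is linear, commutes with x and kills 1, and 1 generates all
    polynomials under multiplication by x and linear combinations.\<close>
  have S_0: "S p = 0" for p
  proof (induction p rule: pCons_induct)
    case 0
    show ?case using S_smult[of 0 1] by simp
  next
    case (pCons a p)
    have "pCons a p = smult a 1 + [:0, 1:] * p" by simp
    then have "S (pCons a p) = smult a (S 1) + [:0, 1:] * S p"
      by (simp only: S_add S_smult S_X)
    then show ?case using S_1 pCons by simp
  qed
  have "\<forall>p. T p = raw_act p r" using S_0 by (simp add: S_def)
  then show ?case by blast
qed


text \<open>Rows are functions on all of \<open>nat\<close> of which only the first \<open>N\<close> values are relevant.\<close>

definition row_act ::
    "nat \<Rightarrow> (nat \<Rightarrow> complex poly) \<Rightarrow> (nat \<Rightarrow> nat \<Rightarrow> complex poly poly) \<Rightarrow> nat \<Rightarrow> complex poly" where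
  "row_act N u D j = (\<Sum>k<N. raw_act (u k) (D k j))"

definition row_comb :: "nat \<Rightarrow> (nat \<Rightarrow> complex) \<Rightarrow> (nat \<Rightarrow> nat \<Rightarrow> complex poly) \<Rightarrow> nat \<Rightarrow> complex poly" where
  "row_comb N c R i = (\<Sum>a<N. smult (c a) (R a i))"

lemma row_act_add: "row_act N (\<lambda>i. u i + v i) D = (\<lambda>j. row_act N u D j + row_act N v D j)"
  by (rule ext) (simp add: row_act_def raw_act_add_left sum.distrib)

lemma row_act_smult: "row_act N (\<lambda>i. smult c (u i)) D = (\<lambda>j. smult c (row_act N u D j))"
  by (rule ext) (simp add: row_act_def raw_act_smult_left smult_sum2)

lemma row_act_cong: "(\<And>i. i < N \<Longrightarrow> u i = v i) \<Longrightarrow> row_act N u D = row_act N v D"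
  by (rule ext) (simp add: row_act_def)

lemma row_act_row_comb: "row_act N (row_comb K c R) D = row_comb K c (\<lambda>a. row_act N (R a) D)"
proof
  fix j
  have "row_act N (row_comb K c R) D j = (\<Sum>k<N. \<Sum>a<K. smult (c a) (raw_act (R a k) (D k j)))"
    by (simp add: row_act_def row_comb_def raw_act_sum_left raw_act_smult_left)
  then show "row_act N (row_comb K c R) D j = row_comb K c (\<lambda>a. row_act N (R a) D) j"
    by (subst (asm) sum.swap) (simp add: row_comb_def row_act_def smult_sum2)
qed

text \<open>The third clause makes the functional blind to the entries from index \<open>N\<close>
  on, which rows carry as total functions.\<close>

definition row_functional :: "nat \<Rightarrow> ((nat \<Rightarrow> complex poly) \<Rightarrow> complex) \<Rightarrow> bool" where
  "row_functional N \<phi> \<longleftrightarrow>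
     (\<forall>u v. \<phi> (\<lambda>i. u i + v i) = \<phi> u + \<phi> v) \<and>
     (\<forall>c u. \<phi> (\<lambda>i. smult c (u i)) = c * \<phi> u) \<and>
     (\<forall>u v. (\<forall>i<N. u i = v i) \<longrightarrow> \<phi> u = \<phi> v)"

lemma row_functionalD:
  assumes "row_functional N \<phi>"
  shows "\<phi> (\<lambda>i. u i + v i) = \<phi> u + \<phi> v" "\<phi> (\<lambda>i. smult c (u i)) = c * \<phi> u"
    "(\<And>i. i < N \<Longrightarrow> u i = v i) \<Longrightarrow> \<phi> u = \<phi> v"
  using assms unfolding row_functional_def by blast+

lemma row_functional_row_comb:
  assumes "row_functional N \<phi>"
  shows "\<phi> (row_comb K c R) = (\<Sum>a<K. c a * \<phi> (R a))"
proof (induction K)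
  case 0
  have "\<phi> (row_comb 0 c R) = \<phi> (\<lambda>i. smult 0 (R 0 i))"
    by (rule row_functionalD[OF assms]) (simp add: row_comb_def)
  then show ?case using row_functionalD(2)[OF assms, of 0] by simp
next
  case (Suc K)
  have "row_comb (Suc K) c R = (\<lambda>i. row_comb K c R i + smult (c K) (R K i))"
    by (rule ext) (simp add: row_comb_def)
  then show ?case
    using row_functionalD(1,2)[OF assms] Suc by simp
qed

section \<open>Invertibility of complex matrices in terms of left kernels\<close>

lemma mult_mat_entry:
  assumes "A \<in> carrier_mat r n" "B \<in> carrier_mat n c" "i < r" "j < c"
  shows "(A * B) $$ (i, j) = (\<Sum>k<n. A $$ (i, k) * B $$ (k, j))"
  using assms by (auto simp: scalar_prod_def atLeast0LessThan intro!: sum.cong)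

text \<open>Triviality of the left kernel is the form in which invertibility meets linear
  combinations of rows. Matrices are functions here, and only the entries with both indices below
  \<open>N\<close> count.\<close>

definition nonsingular :: "nat \<Rightarrow> (nat \<Rightarrow> nat \<Rightarrow> complex) \<Rightarrow> bool" where
  "nonsingular N G \<longleftrightarrow> (\<forall>c. (\<forall>b<N. (\<Sum>a<N. c a * G a b) = 0) \<longrightarrow> (\<forall>a<N. c a = 0))"

lemma nonsingularD:
  "nonsingular N G \<Longrightarrow> (\<And>b. b < N \<Longrightarrow> (\<Sum>a<N. c a * G a b) = 0) \<Longrightarrow> a < N \<Longrightarrow> c a = 0"
  unfolding nonsingular_def by blast

text \<open>Transposition turns the left kernel into the right kernel, which is nonzero exactly when
  the determinant vanishes.\<close>

lemma det_nonsingular: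
  "nonsingular N G \<longleftrightarrow> det (mat N N (\<lambda>(a, b). G a b)) \<noteq> 0"
proof -
  let ?M = "mat N N (\<lambda>(a, b). G b a)"
  have M: "?M \<in> carrier_mat N N" by simp
  have "?M = transpose_mat (mat N N (\<lambda>(a, b). G a b))" by (rule eq_matI) auto
  then have *: "det (mat N N (\<lambda>(a, b). G a b)) = det ?M"
    using det_transpose[of "mat N N (\<lambda>(a, b). G a b)" N] by simp
  have e: "(?M *\<^sub>v v) $ b = (\<Sum>a<N. v $ a * G a b)" if "v \<in> carrier_vec N" "b < N" for v b
    using that by (auto simp: scalar_prod_def lessThan_atLeast0 mult.commute intro!: sum.cong)
  show ?thesis
    unfolding * det_0_iff_vec_prod_zero_field[OF M]
  proof
    assume ns: "nonsingular N G"
    show "\<not> (\<exists>v. v \<in> carrier_vec N \<and> v \<noteq> 0\<^sub>v N \<and> ?M *\<^sub>v v = 0\<^sub>v N)"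
    proof clarify
      fix v assume v: "v \<in> carrier_vec N" "v \<noteq> 0\<^sub>v N" "?M *\<^sub>v v = 0\<^sub>v N"
      have "v $ a = 0" if "a < N" for a
      proof (rule nonsingularD[OF ns _ that])
        fix b assume "b < N"
        then show "(\<Sum>a<N. v $ a * G a b) = 0"
          using e[OF v(1), of b] v(3) by simp
      qed
      then have "v = 0\<^sub>v N" using v(1) by (intro eq_vecI) auto
      then show False using v(2) by simp
    qed
  next
    assume H: "\<not> (\<exists>v. v \<in> carrier_vec N \<and> v \<noteq> 0\<^sub>v N \<and> ?M *\<^sub>v v = 0\<^sub>v N)"
    show "nonsingular N G"
      unfolding nonsingular_def
    proof (intro allI impI)
      fix c a assume c: "\<forall>b<N. (\<Sum>a<N. c a * G a b) = 0" and a: "a < N"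
      define v where "v = vec N c"
      have v: "v \<in> carrier_vec N" by (simp add: v_def)
      have "?M *\<^sub>v v = 0\<^sub>v N"
      proof (rule eq_vecI)
        fix b assume "b < dim_vec (0\<^sub>v N :: complex vec)"
        then have b: "b < N" by simp
        have "(\<Sum>a<N. v $ a * G a b) = (\<Sum>a<N. c a * G a b)"
          by (intro sum.cong) (auto simp: v_def)
        then show "(?M *\<^sub>v v) $ b = 0\<^sub>v N $ b" using e[OF v b] c b by simp
      qed simp
      then have "v = 0\<^sub>v N" using H v by blast
      then have "v $ a = 0" using a by simp
      then show "c a = 0" using a by (simp add: v_def)
    qed
  qed
qed

lemma nonsingular_cong:
  assumes "\<And>a b. a < N \<Longrightarrow> b < N \<Longrightarrow> G a b = G' a b"
  shows "nonsingular N G \<longleftrightarrow> nonsingular N G'"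
proof -
  have "mat N N (\<lambda>(a, b). G a b) = mat N N (\<lambda>(a, b). G' a b)"
    by (rule eq_matI) (simp_all add: assms)
  then show ?thesis by (simp add: det_nonsingular)
qed

lemma invertible_mat_nonsingular:
  assumes "A \<in> carrier_mat N N"
  shows "invertible_mat A \<longleftrightarrow> nonsingular N (\<lambda>a b. A $$ (a, b))"
proof -
  have A: "mat N N (\<lambda>(a, b). A $$ (a, b)) = A" using assms by (intro eq_matI) auto
  have "invertible_mat A \<longleftrightarrow> det A \<noteq> 0"
  proof
    assume "invertible_mat A"
    then obtain B where B: "A * B = 1\<^sub>m N" "B * A = 1\<^sub>m (dim_row B)"
      using assms unfolding invertible_mat_def inverts_mat_def by auto
    \<comment> \<open>\<open>invertible_mat\<close> does not fix the shape of the inverse; the two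
      products do.\<close>
    have "dim_col B = N" using arg_cong[OF B(1), of dim_col] by simp
    moreover have "dim_row B = N" using arg_cong[OF B(2), of dim_col] assms by simp
    ultimately have "B \<in> carrier_mat N N" by (rule carrier_matI[rotated])
    from det_mult[OF assms this] have "det A * det B = 1" unfolding B(1) by simp
    then show "det A \<noteq> 0" by auto
  next
    assume "det A \<noteq> 0"
    from det_non_zero_imp_unit[OF assms this, of "()"] obtain B
      where "B \<in> carrier_mat N N" "B * A = 1\<^sub>m N" "A * B = 1\<^sub>m N"
      by (auto simp: Units_def ring_mat_def)
    then show "invertible_mat A"
      using assms unfolding invertible_mat_def inverts_mat_def by auto
  qed
  then show ?thesis unfolding det_nonsingular A .
qed

lemma nonsingular_solve:
  assumes "nonsingular N G"
  shows "\<exists>x. \<forall>b<N. (\<Sum>a<N. x a * G a b) = y b"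
    and "\<exists>x. \<forall>a<N. (\<Sum>b<N. G a b * x b) = y a"
proof -
  let ?A = "mat N N (\<lambda>(a, b). G a b)"
  have A: "?A \<in> carrier_mat N N" by simp
  have "det ?A \<noteq> 0" using assms unfolding det_nonsingular .
  from det_non_zero_imp_unit[OF A this, of "()"] obtain B
    where B: "B \<in> carrier_mat N N" "B * ?A = 1\<^sub>m N" "?A * B = 1\<^sub>m N"
    unfolding Units_def ring_mat_def by auto
  have l: "(\<Sum>k<N. B $$ (a, k) * G k b) = (if a = b then 1 else 0)" if "a < N" "b < N" for a b
  proof -
    have "(B * ?A) $$ (a, b) = (\<Sum>k<N. B $$ (a, k) * G k b)"
      using that B(1) by (auto simp: scalar_prod_def atLeast0LessThan intro!: sum.cong)
    then show ?thesis using that unfolding B(2) by simp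
  qed
  have r: "(\<Sum>k<N. G a k * B $$ (k, b)) = (if a = b then 1 else 0)" if "a < N" "b < N" for a b
  proof -
    have "(?A * B) $$ (a, b) = (\<Sum>k<N. G a k * B $$ (k, b))"
      using that B(1) by (auto simp: scalar_prod_def atLeast0LessThan intro!: sum.cong)
    then show ?thesis using that unfolding B(3) by simp
  qed
  have "(\<Sum>a<N. (\<Sum>c<N. y c * B $$ (c, a)) * G a b) = y b" if "b < N" for b
  proof -
    have "(\<Sum>a<N. (\<Sum>c<N. y c * B $$ (c, a)) * G a b) = (\<Sum>a<N. \<Sum>c<N. y c * (B $$ (c, a) * G a b))"
      by (simp add: sum_distrib_right mult.assoc)
    also have "\<dots> = (\<Sum>c<N. y c * (\<Sum>a<N. B $$ (c, a) * G a b))"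
      by (subst sum.swap) (simp add: sum_distrib_left)
    also have "\<dots> = (\<Sum>c<N. if c = b then y c else 0)"
      using that by (intro sum.cong) (auto simp: l)
    finally show ?thesis using that by simp
  qed
  then show "\<exists>x. \<forall>b<N. (\<Sum>a<N. x a * G a b) = y b" by (intro exI allI impI)
  have "(\<Sum>b<N. G a b * (\<Sum>c<N. B $$ (b, c) * y c)) = y a" if "a < N" for a
  proof -
    have "(\<Sum>b<N. G a b * (\<Sum>c<N. B $$ (b, c) * y c)) = (\<Sum>b<N. \<Sum>c<N. (G a b * B $$ (b, c)) * y c)"
      by (simp add: sum_distrib_left mult.assoc)
    also have "\<dots> = (\<Sum>c<N. (\<Sum>b<N. G a b * B $$ (b, c)) * y c)"
      by (subst sum.swap) (simp add: sum_distrib_right)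
    also have "\<dots> = (\<Sum>c<N. if a = c then y c else 0)"
      using that by (intro sum.cong) (auto simp: r)
    finally show ?thesis using that by simp
  qed
  then show "\<exists>x. \<forall>a<N. (\<Sum>b<N. G a b * x b) = y a" by (intro exI allI impI)
qed

section \<open>Hermitian forms on polynomial rows\<close>

abbreviation X_row :: "(nat \<Rightarrow> complex poly) \<Rightarrow> nat \<Rightarrow> complex poly" where
  "X_row u \<equiv> (\<lambda>i. [:0, 1:] * u i)"

text \<open>A strict bound instead of a degree: \<open>n = 0\<close> then describes the zero row,
  which starts the inductions on \<open>n\<close>.\<close>

definition row_deg_less :: "nat \<Rightarrow> nat \<Rightarrow> (nat \<Rightarrow> complex poly) \<Rightarrow> bool" where
  "row_deg_less N n u \<longleftrightarrow> (\<forall>i<N. \<forall>k\<ge>n. coeff (u i) k = 0)"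

lemma row_deg_less_0: "row_deg_less N 0 u \<longleftrightarrow> (\<forall>i<N. u i = 0)"
  by (auto simp: row_deg_less_def poly_eq_iff)

lemma ex_row_deg_less: "\<exists>n. row_deg_less N n u"
proof
  show "row_deg_less N (Suc (\<Sum>i<N. degree (u i))) u"
    unfolding row_deg_less_def
  proof (intro allI impI)
    fix i k assume "i < N" "Suc (\<Sum>i<N. degree (u i)) \<le> k"
    then have "degree (u i) < k"
      using member_le_sum[of i "{..<N}" "\<lambda>i. degree (u i)"] by simp
    then show "coeff (u i) k = 0" by (rule coeff_eq_0)
  qed
qed

lemma row_comb_row_comb: "row_comb K c (\<lambda>a. row_comb N (A a) R) = row_comb N (\<lambda>b. \<Sum>a<K. c a * A a b) R"
proof
  fix i
  have "row_comb K c (\<lambda>a. row_comb N (A a) R) i = (\<Sum>a<K. \<Sum>b<N. smult (c a * A a b) (R b i))"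
    by (simp add: row_comb_def smult_sum2)
  also have "\<dots> = row_comb N (\<lambda>b. \<Sum>a<K. c a * A a b) R i"
    by (subst sum.swap) (simp add: row_comb_def smult_sum)
  finally show "row_comb K c (\<lambda>a. row_comb N (A a) R) i = row_comb N (\<lambda>b. \<Sum>a<K. c a * A a b) R i" .
qed

lemma row_comb_cong: "(\<And>a. a < N \<Longrightarrow> R a i = R' a i) \<Longrightarrow> row_comb N c R i = row_comb N c R' i"
  by (simp add: row_comb_def)

lemma row_comb_eq_0: "(\<And>a. a < N \<Longrightarrow> c a = 0) \<Longrightarrow> row_comb N c R i = 0"
  by (simp add: row_comb_def)

lemma coeff_row_comb: "coeff (row_comb N c R i) k = (\<Sum>a<N. c a * coeff (R a i) k)"
  by (simp add: row_comb_def coeff_sum)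

text \<open>Abstracts the form given by integrating \<open>u W v*\<close>.
  \<open>X_symmetric\<close> reflects that x is a real scalar and so passes from one side of the
  weight to the other; \<open>definite\<close> speaks of the real part, but \<open>hermitian\<close>
  makes \<open>B u u\<close> real.\<close>

locale row_form =
  fixes N :: nat and B :: "(nat \<Rightarrow> complex poly) \<Rightarrow> (nat \<Rightarrow> complex poly) \<Rightarrow> complex"
  assumes functional: "row_functional N (\<lambda>u. B u v)"
    and hermitian: "B v u = cnj (B u v)"
    and X_symmetric: "B (X_row u) v = B u (X_row v)"
    and definite: "i < N \<Longrightarrow> u i \<noteq> 0 \<Longrightarrow> 0 < Re (B u u)"
begin

lemma B_add: "B (\<lambda>i. u i + u' i) v = B u v + B u' v"
  using row_functionalD(1)[OF functional] .

lemma B_smult: "B (\<lambda>i. smult c (u i)) v = c * B u v"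
  using row_functionalD(2)[OF functional] .

lemma B_cong: "(\<And>i. i < N \<Longrightarrow> u i = u' i) \<Longrightarrow> B u v = B u' v"
  using row_functionalD(3)[OF functional] .

lemma B_diff: "B (\<lambda>i. u i - u' i) v = B u v - B u' v"
  using B_add[of u "\<lambda>i. smult (-1) (u' i)" v] B_smult[of "-1" u' v] by simp

lemma B_diff_right: "B v (\<lambda>i. u i - u' i) = B v u - B v u'"
  unfolding hermitian[of v] B_diff by simp

lemma B_add_right: "B v (\<lambda>i. u i + u' i) = B v u + B v u'"
  unfolding hermitian[of v] B_add by simp

lemma B_smult_right: "B v (\<lambda>i. smult c (u i)) = cnj c * B v u"
  unfolding hermitian[of v] B_smult by simp

lemma B_cong_right: "(\<And>i. i < N \<Longrightarrow> u i = u' i) \<Longrightarrow> B v u = B v u'"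
  unfolding hermitian[of v] by (simp add: B_cong[of u u'])

lemma B_row_comb: "B (row_comb K c R) v = (\<Sum>a<K. c a * B (R a) v)"
  using row_functional_row_comb[OF functional] .

lemma B_row_comb_right: "B v (row_comb K c R) = (\<Sum>a<K. cnj (c a) * B v (R a))"
  unfolding hermitian[of v] B_row_comb by simp

lemma B_zero: "(\<And>i. i < N \<Longrightarrow> u i = 0) \<Longrightarrow> B u v = 0"
  using B_cong[of u "\<lambda>i. smult 0 (u i)" v] B_smult[of 0 u v] by simp

lemma B_zero_right: "(\<And>i. i < N \<Longrightarrow> u i = 0) \<Longrightarrow> B v u = 0"
  using B_zero[of u v] hermitian[of v u] by simp

lemma B_definite: "B u u = 0 \<Longrightarrow> i < N \<Longrightarrow> u i = 0"
  using definite[of i u] by fastforce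

text \<open>The difference of the two rows, used as test row, has norm 0. This is the uniqueness of
  the vector that represents a functional.\<close>

lemma B_ext:
  assumes "\<And>u. B u v = B u v'" "i < N"
  shows "v i = v' i"
  using B_definite[of "\<lambda>i. v i - v' i" i] assms by (simp add: B_diff_right)

end

text \<open>\<open>P n a\<close> is row \<open>a\<close> of the matrix polynomial
  \<open>P n\<close>. Orthogonality is asked only between different degrees; the rows of a single
  \<open>P n\<close> may have any Gram matrix.\<close>

locale orth_rows = row_form +
  fixes P :: "nat \<Rightarrow> nat \<Rightarrow> nat \<Rightarrow> complex poly"
  assumes deg: "a < N \<Longrightarrow> row_deg_less N (Suc n) (P n a)"
    and lead: "nonsingular N (\<lambda>a i. coeff (P n a i) n)"
    and orth: "n \<noteq> m \<Longrightarrow> a < N \<Longrightarrow> b < N \<Longrightarrow> B (P n a) (P m b) = 0"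
begin

lemma row_comb_P_eq_0:
  assumes "\<And>i. i < N \<Longrightarrow> row_comb N c (P n) i = 0" "a < N"
  shows "c a = 0"
proof (rule nonsingularD[OF lead[of n] _ assms(2)])
  fix i assume "i < N"
  then show "(\<Sum>a<N. c a * coeff (P n a i) n) = 0"
    using assms(1) coeff_row_comb[of N c "P n" i n] by simp
qed

lemma row_deg_less_row_comb: "row_deg_less N (Suc n) (row_comb N c (P n))"
  using deg[of _ n] by (simp add: row_deg_less_def coeff_row_comb)

text \<open>The top coefficients of the rows of \<open>P n\<close> form a basis of the constant
  rows, so the terms of degree \<open>n\<close> can be subtracted. Repeating this expands any row in
  rows of the \<open>P m\<close>.\<close>

lemma split_leading:
  assumes "row_deg_less N (Suc n) u"
  obtains c v where "\<And>i. u i = row_comb N c (P n) i + v i" "row_deg_less N n v"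
proof -
  obtain c where c: "\<forall>i<N. (\<Sum>a<N. c a * coeff (P n a i) n) = coeff (u i) n"
    using nonsingular_solve(1)[OF lead[of n], of "\<lambda>i. coeff (u i) n"] by (elim exE)
  show thesis
  proof (rule that)
    show "u i = row_comb N c (P n) i + (u i - row_comb N c (P n) i)" for i by simp
    show "row_deg_less N n (\<lambda>i. u i - row_comb N c (P n) i)"
      unfolding row_deg_less_def
    proof (intro allI impI)
      fix i k assume i: "i < N" and "n \<le> k"
      then consider "k = n" | "Suc n \<le> k" by linarith
      then show "coeff (u i - row_comb N c (P n) i) k = 0"
      proof cases
        case 1
        then show ?thesis using c i by (simp add: coeff_row_comb)
      next
        case 2
        then show ?thesis
          using assms row_deg_less_row_comb[of n c] i unfolding row_deg_less_def by simp
      qed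
    qed
  qed
qed

text \<open>On the first \<open>N\<close> entries, the rows of \<open>P m\<close> with
  \<open>m < n\<close> span all rows of degree below \<open>n\<close>.\<close>

lemma functional_eq_0:
  assumes "row_functional N \<phi>" "\<And>m a. m < n \<Longrightarrow> a < N \<Longrightarrow> \<phi> (P m a) = 0"
    and "row_deg_less N n u"
  shows "\<phi> u = 0"
  using assms(2,3)
proof (induction n arbitrary: u)
  case 0
  then have "\<phi> u = \<phi> (\<lambda>i. smult 0 (u i))"
    by (intro row_functionalD(3)[OF assms(1)]) (simp add: row_deg_less_0)
  then show ?case using row_functionalD(2)[OF assms(1), of 0 u] by simp
next
  case (Suc n)
  from Suc.prems(2) obtain c v
    where u: "\<And>i. u i = row_comb N c (P n) i + v i" and v: "row_deg_less N n v"
    by (rule split_leading) blast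
  have "u = (\<lambda>i. row_comb N c (P n) i + v i)" by (rule ext) (rule u)
  then have "\<phi> u = \<phi> (row_comb N c (P n)) + \<phi> v"
    using row_functionalD(1)[OF assms(1)] by simp
  moreover have "\<phi> v = 0" using Suc v by simp
  moreover have "\<phi> (row_comb N c (P n)) = 0"
    unfolding row_functional_row_comb[OF assms(1)] using Suc.prems(1) by simp
  ultimately show ?case by simp
qed

lemma orth_lower:
  assumes "row_deg_less N n u" "n \<le> m" "a < N"
  shows "B u (P m a) = 0" "B (P m a) u = 0"
proof -
  show "B u (P m a) = 0"
    by (rule functional_eq_0[OF functional _ assms(1)]) (use assms orth in auto)
  then show "B (P m a) u = 0" using hermitian[of "P m a" u] by simp
qed

text \<open>In the expansion of \<open>R\<close> the top component at a degree other than
  \<open>n\<close> is orthogonal to itself, so the degree of \<open>R\<close> drops to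
  \<open>n\<close>. The part below degree \<open>n\<close> then vanishes for the same
  reason.\<close>

lemma orth_complement:
  assumes "\<And>m a. m \<noteq> n \<Longrightarrow> a < N \<Longrightarrow> B R (P m a) = 0"
  shows "\<exists>c. \<forall>i<N. R i = row_comb N c (P n) i"
proof -
  \<comment> \<open>\<open>B R ?w\<close> and \<open>B v ?w\<close> both vanish, the second because
    \<open>v\<close> has degree below \<open>m\<close>; hence so does
    \<open>B ?w ?w\<close>.\<close>
  have split0: "row_deg_less N m R" if m: "n \<noteq> m" "row_deg_less N (Suc m) R" for m
  proof -
    from m(2) obtain c v where u: "\<And>i. R i = row_comb N c (P m) i + v i" and v: "row_deg_less N m v"
      by (rule split_leading) blast
    let ?w = "row_comb N c (P m)"
    have "B R ?w = 0" using assms m by (simp add: B_row_comb_right)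
    moreover have "B v ?w = 0" using orth_lower(1)[OF v] by (simp add: B_row_comb_right)
    moreover have "R = (\<lambda>i. ?w i + v i)" by (rule ext) (rule u)
    ultimately have "B ?w ?w = 0" using B_add[of ?w v ?w] by simp
    then have "?w i = 0" if "i < N" for i using that by (rule B_definite)
    then have "R i = v i" if "i < N" for i using that u by simp
    then show ?thesis using v by (simp add: row_deg_less_def)
  qed
  have low: "row_deg_less N (Suc n) R"
  proof -
    obtain m where "row_deg_less N m R" using ex_row_deg_less by blast
    \<comment> \<open>The bound is raised to the form \<open>Suc n + m\<close>, so that the descent
      over \<open>m\<close> stops just above degree \<open>n\<close>.\<close>
    then have "row_deg_less N (Suc n + m) R" by (simp add: row_deg_less_def)
    then show ?thesis
    proof (induction m)
      case (Suc m)
      then show ?case using split0[of "Suc n + m"] by simp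
    qed simp
  qed
  then obtain c v where u: "\<And>i. R i = row_comb N c (P n) i + v i" and v: "row_deg_less N n v"
    by (rule split_leading) blast
  have R: "R = (\<lambda>i. row_comb N c (P n) i + v i)" by (rule ext) (rule u)
  \<comment> \<open>\<open>v\<close> inherits orthogonality to the lower \<open>P m\<close> from
    \<open>R\<close>, because the rows of \<open>P n\<close> have it too; and the lower
    \<open>P m\<close> span the rows of the degree of \<open>v\<close>.\<close>
  have "B v v = 0"
  proof (rule functional_eq_0[OF functional _ v])
    fix m a assume m: "m < n" "a < N"
    have "B R (P m a) = 0" using assms m by simp
    moreover have "B (row_comb N c (P n)) (P m a) = 0" using orth m by (simp add: B_row_comb)
    ultimately have "B v (P m a) = 0"
      using B_add[of "row_comb N c (P n)" v "P m a"] unfolding R[symmetric] by simp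
    then show "B (P m a) v = 0" using hermitian[of "P m a" v] by simp
  qed
  then have "v i = 0" if "i < N" for i using that by (rule B_definite)
  then show ?thesis using u by auto
qed

text \<open>A vector in the left kernel of the Gram matrix gives a combination of the rows of
  \<open>P n\<close> of norm 0, and these rows are linearly independent.\<close>

lemma gram_nonsingular: "nonsingular N (\<lambda>a b. B (P n a) (P n b))"
  unfolding nonsingular_def
proof (intro allI impI)
  fix c a assume c: "\<forall>b<N. (\<Sum>a<N. c a * B (P n a) (P n b)) = 0" and a: "a < N"
  have "B (row_comb N c (P n)) (row_comb N c (P n)) = 0"
    by (subst B_row_comb_right) (simp add: B_row_comb c)
  then have "row_comb N c (P n) i = 0" if "i < N" for i using that by (rule B_definite)
  then show "c a = 0" using a by (rule row_comb_P_eq_0)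
qed

text \<open>Only finitely many values of \<phi> on the rows of the \<open>P m\<close> are nonzero.
  They are removed degree by degree from the top, each time by subtracting a functional represented
  by a combination of rows of \<open>P n\<close>.\<close>

lemma riesz:
  assumes "row_functional N \<phi>" "\<And>m a. n \<le> m \<Longrightarrow> a < N \<Longrightarrow> \<phi> (P m a) = 0"
  shows "\<exists>R. \<forall>u. \<phi> u = B u R"
  using assms
proof (induction n arbitrary: \<phi>)
  case 0
  have "\<phi> u = B u (\<lambda>_. 0)" for u
  proof -
    obtain n where "row_deg_less N n u" using ex_row_deg_less by blast
    then have "\<phi> u = 0" using functional_eq_0[OF 0(1)] 0(2) by simp
    then show ?thesis using B_zero_right by simp
  qed
  then show ?case by blast
next
  case (Suc n)
  obtain x where x: "\<forall>a<N. (\<Sum>b<N. B (P n a) (P n b) * x b) = \<phi> (P n a)"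
    using nonsingular_solve(2)[OF gram_nonsingular[of n], of "\<lambda>a. \<phi> (P n a)"] by (elim exE)
  \<comment> \<open>The form is conjugate-linear on the right, so conjugated coefficients make
    \<open>B (P n a) w\<close> equal to \<open>\<phi> (P n a)\<close>.\<close>
  define w where "w = row_comb N (\<lambda>b. cnj (x b)) (P n)"
  have "\<exists>R. \<forall>u. \<phi> u - B u w = B u R"
  proof (rule Suc.IH)
    show "row_functional N (\<lambda>u. \<phi> u - B u w)"
      using Suc.prems(1) functional[of w] unfolding row_functional_def
      by (simp add: algebra_simps) metis
  next
    fix m a assume m: "n \<le> m" "a < N"
    have "B (P m a) w = (\<Sum>b<N. B (P m a) (P n b) * x b)"
      by (simp add: w_def B_row_comb_right mult.commute)
    also have "\<dots> = \<phi> (P m a)"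
    proof (cases "m = n")
      case True
      then show ?thesis using x m by simp
    next
      case False
      then show ?thesis using m Suc.prems(2)[of m a] orth[OF False] by simp
    qed
    finally show "\<phi> (P m a) - B (P m a) w = 0" by simp
  qed
  then obtain R where R: "\<And>u. \<phi> u - B u w = B u R" by blast
  have "\<phi> u = B u (\<lambda>i. R i + w i)" for u
    using R[of u] by (simp add: B_add_right algebra_simps)
  then show ?case by blast
qed

end

section \<open>Commutators with x on rows, and their behaviour under adjunction\<close>

definition row_ad ::
    "((nat \<Rightarrow> complex poly) \<Rightarrow> nat \<Rightarrow> complex poly) \<Rightarrow>
     (nat \<Rightarrow> complex poly) \<Rightarrow> nat \<Rightarrow> complex poly" where
  "row_ad S u i = S (X_row u) i - [:0, 1:] * S u i"

lemma row_ad_row_act: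
  "(row_ad ^^ s) (\<lambda>u. row_act N u D) = (\<lambda>u. row_act N u (\<lambda>k j. (pderiv ^^ s) (D k j)))"
proof (induction s)
  case (Suc s)
  have "row_ad (\<lambda>u. row_act N u E) = (\<lambda>u. row_act N u (\<lambda>k j. pderiv (E k j)))" for E
    by (intro ext)
       (simp add: row_ad_def row_act_def sum_distrib_left sum_subtractf[symmetric] raw_act_X_mult
         del: mult_pCons_left)
  then show ?case by (simp add: Suc)
qed simp

abbreviation unit_row :: "nat \<Rightarrow> complex poly \<Rightarrow> nat \<Rightarrow> complex poly" where
  "unit_row i p \<equiv> (\<lambda>k. if k = i then p else 0)"

text \<open>Multiplication by x maps unit rows to unit rows at the same position, so each entry of
  \<open>T\<close> can be treated as a map on scalar polynomials.\<close>

lemma row_ad_unit_row: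
  "(row_ad ^^ s) T (unit_row i p) j = (ad_X ^^ s) (\<lambda>p. T (unit_row i p) j) p"
proof (induction s arbitrary: T)
  case (Suc s)
  have "X_row (unit_row i p) = unit_row i ([:0, 1:] * p)" for p
    by (rule ext) simp
  then have "(\<lambda>p. row_ad T (unit_row i p) j) = ad_X (\<lambda>p. T (unit_row i p) j)"
    by (intro ext) (simp only: row_ad_def ad_X_def)
  then show ?case
    using Suc[of "row_ad T"] by (simp add: funpow_swap1)
qed simp

text \<open>Since x is symmetric for both forms, passing to the adjoint exchanges the two terms of a
  commutator; each commutator thus contributes one sign.\<close>

lemma row_ad_adjoint:
  assumes "row_form N B" "row_form N' B'" "\<And>u v. B' (S u) v = B u (T v)"
  shows "B' ((row_ad ^^ s) S u) v = (-1) ^ s * B u ((row_ad ^^ s) T v)"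
proof (induction s arbitrary: u v)
  case 0
  show ?case by (simp add: assms)
next
  case (Suc s)
  let ?S = "(row_ad ^^ s) S" and ?T = "(row_ad ^^ s) T"
  interpret B: row_form N B by fact
  interpret B': row_form N' B' by fact
  have "B' (row_ad ?S u) v = B' (?S (X_row u)) v - B' (X_row (?S u)) v"
    unfolding row_ad_def[abs_def] by (rule B'.B_diff)
  also have "\<dots> = B' (?S (X_row u)) v - B' (?S u) (X_row v)"
    by (simp only: B'.X_symmetric)
  also have "\<dots> = (-1) ^ s * (B u (X_row (?T v)) - B u (?T (X_row v)))"
    by (simp only: Suc B.X_symmetric right_diff_distrib)
  also have "B u (X_row (?T v)) - B u (?T (X_row v)) = - B u (row_ad ?T v)"
    unfolding row_ad_def[abs_def] by (simp only: B.B_diff_right minus_diff_eq)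
  finally show ?case by simp
qed

section \<open>Intertwining operators and their adjoints\<close>

text \<open>The relation that \<open>D\<close> sends \<open>P n\<close> to \<open>G n\<close> times
  \<open>Q n\<close>, row by row. In the proof of the theorem it is instantiated in both directions
  between the given sequence and the direct sum.\<close>

locale intertwiner = P: orth_rows N B P + Q: orth_rows N B' Q
  for N B P B' Q +
  fixes D :: "nat \<Rightarrow> nat \<Rightarrow> complex poly poly" and G :: "nat \<Rightarrow> nat \<Rightarrow> nat \<Rightarrow> complex"
  assumes intertwines: "a < N \<Longrightarrow> j < N \<Longrightarrow> row_act N (P n a) D j = row_comb N (G n a) (Q n) j"
begin

lemma row_act_comb_P:
  assumes "j < N"
  shows "row_act N (row_comb N c (P n)) D j = row_comb N (\<lambda>b. \<Sum>a<N. c a * G n a b) (Q n) j"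
  unfolding row_act_row_comb row_comb_row_comb[symmetric]
  by (rule row_comb_cong) (simp add: intertwines assms)

lemma adjoint_row_exists: "\<exists>R. \<forall>u. B' (row_act N u D) v = B u R"
proof -
  obtain n where n: "row_deg_less N n v" using ex_row_deg_less by blast
  show ?thesis
  proof (rule P.riesz)
    show "row_functional N (\<lambda>u. B' (row_act N u D) v)"
      unfolding row_functional_def
    proof (intro conjI allI impI)
      fix u w
      show "B' (row_act N (\<lambda>i. u i + w i) D) v = B' (row_act N u D) v + B' (row_act N w D) v"
        unfolding row_act_add by (rule Q.B_add)
      assume "\<forall>i<N. u i = w i"
      then show "B' (row_act N u D) v = B' (row_act N w D) v"
        using row_act_cong[of N u w D] by simp
    next
      fix c u
      show "B' (row_act N (\<lambda>i. smult c (u i)) D) v = c * B' (row_act N u D) v"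
        unfolding row_act_smult by (rule Q.B_smult)
    qed
  next
    fix m a assume m: "n \<le> m" "a < N"
    \<comment> \<open>The image is a combination of rows of \<open>Q m\<close>, which are orthogonal
      to \<open>v\<close> because \<open>v\<close> has degree below
      \<open>n \<le> m\<close>.\<close>
    have "B' (row_act N (P m a) D) v = B' (row_comb N (G m a) (Q m)) v"
      using m by (intro Q.B_cong intertwines)
    also have "\<dots> = 0"
      using Q.orth_lower(2)[OF n m(1)] by (simp add: Q.B_row_comb)
    finally show "B' (row_act N (P m a) D) v = 0" .
  qed
qed

theorem adjoint_exists: "\<exists>V. \<forall>u v. B' (row_act N u D) v = B u (row_act N v V)"
proof -
  obtain T where T: "\<And>u v. B' (row_act N u D) v = B u (T v)"
    using adjoint_row_exists by metis
  \<comment> \<open>\<open>T\<close> is chosen row by row; it is linear because the form determines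
    the first \<open>N\<close> entries of its values.\<close>
  have T_add: "T (\<lambda>i. u i + v i) j = T u j + T v j" if "j < N" for u v j
    using that
  proof (rule P.B_ext[rotated])
    fix x
    show "B x (T (\<lambda>i. u i + v i)) = B x (\<lambda>j. T u j + T v j)"
      unfolding P.B_add_right T[symmetric] by (rule Q.B_add_right)
  qed
  have T_smult: "T (\<lambda>i. smult c (u i)) j = smult c (T u j)" if "j < N" for c u j
    using that
  proof (rule P.B_ext[rotated])
    fix x
    show "B x (T (\<lambda>i. smult c (u i))) = B x (\<lambda>j. smult c (T u j))"
      unfolding P.B_smult_right T[symmetric] by (rule Q.B_smult_right)
  qed
  \<comment> \<open>Larger than the order of every entry of \<open>D\<close>, so that
    \<open>s\<close> commutators with x annihilate the action of \<open>D\<close>.\<close>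
  define s where "s = Suc (\<Sum>k<N. \<Sum>j<N. degree (D k j))"
  have D_s: "(pderiv ^^ s) (D k j) = 0" if "k < N" "j < N" for k j
  proof (rule higher_pderiv_eq_0)
    have "degree (D k j) \<le> (\<Sum>j<N. degree (D k j))"
      using that member_le_sum[of j "{..<N}" "\<lambda>j. degree (D k j)"] by simp
    also have "\<dots> \<le> (\<Sum>k<N. \<Sum>j<N. degree (D k j))"
      using that member_le_sum[of k "{..<N}" "\<lambda>k. \<Sum>j<N. degree (D k j)"] by simp
    finally show "degree (D k j) < s" by (simp add: s_def)
  qed
  have "(row_ad ^^ s) T v j = 0" if "j < N" for v j
    using that
  proof (rule P.B_ext[rotated])
    fix u
    have "B' ((row_ad ^^ s) (\<lambda>u. row_act N u D) u) v = 0"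
      unfolding row_ad_row_act by (rule Q.B_zero) (simp add: row_act_def D_s)
    then show "B u ((row_ad ^^ s) T v) = B u (\<lambda>_. 0)"
      using row_ad_adjoint[OF P.row_form_axioms Q.row_form_axioms T] P.B_zero_right by simp
  qed
  \<comment> \<open>Entry \<open>(i, j)\<close> of \<open>T\<close> is the scalar map that puts
    \<open>p\<close> at position \<open>i\<close> and reads off position \<open>j\<close>; it is
    linear and its \<open>s\<close>-fold commutator vanishes.\<close>
  then have ex: "\<exists>q. \<forall>p. T (unit_row i p) j = raw_act p q" if "j < N" for i j
  proof (intro ad_X_nilpotent_imp_raw_act[where s = s])
    fix p q c
    have "T (unit_row i (p + q)) j = T (\<lambda>k. unit_row i p k + unit_row i q k) j"
      by (intro arg_cong[of _ _ "\<lambda>u. T u j"] ext) simp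
    then show "T (unit_row i (p + q)) j = T (unit_row i p) j + T (unit_row i q) j"
      using T_add that by simp
    have "T (unit_row i (smult c p)) j = T (\<lambda>k. smult c (unit_row i p k)) j"
      by (intro arg_cong[of _ _ "\<lambda>u. T u j"] ext) simp
    then show "T (unit_row i (smult c p)) j = smult c (T (unit_row i p) j)"
      using T_smult that by simp
  qed (use that in \<open>simp add: row_ad_unit_row[symmetric]\<close>)
  define V where "V i j = (SOME q. \<forall>p. T (unit_row i p) j = raw_act p q)" for i j
  have V: "T (unit_row i p) j = raw_act p (V i j)" if "j < N" for i j p
    by (rule someI_ex[OF ex[OF that], folded V_def, THEN spec])
  show ?thesis
  proof (intro exI[where x = V] allI)
    fix u v
    \<comment> \<open>\<open>v\<close> is cut into unit rows, on which \<open>V\<close> agrees with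
      \<open>T\<close>; the adjoint relation holds for each of them and is summed up again.\<close>
    have "B u (row_act N v V) = B u (row_comb N (\<lambda>_. 1) (\<lambda>i. T (unit_row i (v i))))"
      by (rule P.B_cong_right) (simp add: row_act_def row_comb_def V)
    also have "\<dots> = (\<Sum>i<N. B u (T (unit_row i (v i))))"
      unfolding P.B_row_comb_right by simp
    also have "\<dots> = B' (row_act N u D) (row_comb N (\<lambda>_. 1) (\<lambda>i. unit_row i (v i)))"
      unfolding Q.B_row_comb_right T by simp
    also have "\<dots> = B' (row_act N u D) v"
      by (rule Q.B_cong_right) (simp add: row_comb_def)
    finally show "B' (row_act N u D) v = B u (row_act N v V)" by simp
  qed
qed

corollary adjoint_intertwiner:
  obtains V A where "intertwiner N B' Q B P V A"
    and "\<And>n. nonsingular N (G n) \<Longrightarrow> nonsingular N (A n)"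
proof -
  obtain V where "\<forall>u v. B' (row_act N u D) v = B u (row_act N v V)"
    using adjoint_exists by (elim exE)
  then have V: "B' (row_act N u D) v = B u (row_act N v V)" for u v by simp
  \<comment> \<open>By adjointness the image of a row of \<open>Q n\<close> is orthogonal to the
    rows of every other \<open>P m\<close>, so it lies in the span of the rows of
    \<open>P n\<close>.\<close>
  have ex: "\<exists>c. \<forall>i<N. row_act N (Q n a) V i = row_comb N c (P n) i" if a: "a < N" for n a
  proof (rule P.orth_complement)
    fix m b assume m: "m \<noteq> n" "b < N"
    have "B (P m b) (row_act N (Q n a) V) = B' (row_comb N (G m b) (Q m)) (Q n a)"
      unfolding V[symmetric] using m by (intro Q.B_cong intertwines)
    also have "\<dots> = 0" using Q.orth[OF m(1)] a by (simp add: Q.B_row_comb)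
    finally show "B (row_act N (Q n a) V) (P m b) = 0"
      using P.hermitian[of "row_act N (Q n a) V" "P m b"] by simp
  qed
  define A where "A n a = (SOME c. \<forall>i<N. row_act N (Q n a) V i = row_comb N c (P n) i)" for n a
  have A: "row_act N (Q n a) V i = row_comb N (A n a) (P n) i" if "a < N" "i < N" for n a i
    using someI_ex[OF ex[OF that(1), of n], folded A_def] that(2) by blast
  interpret A: intertwiner N B' Q B P V A by unfold_locales (rule A)
  have "nonsingular N (A n)" if G: "nonsingular N (G n)" for n
    unfolding nonsingular_def
  proof (intro allI impI)
    fix c a assume c: "\<forall>b<N. (\<Sum>a<N. c a * A n a b) = 0" and a: "a < N"
    let ?w = "row_comb N c (Q n)"
    \<comment> \<open>Since \<open>G n\<close> is nonsingular, \<open>?w\<close> is the image under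
      \<open>D\<close> of a combination of rows of \<open>P n\<close>. Moving \<open>D\<close>
      across the form turns it into \<open>V\<close> acting on \<open>?w\<close>, which is 0 by the
      choice of \<open>c\<close>.\<close>
    obtain r where r: "\<forall>b<N. (\<Sum>a<N. r a * G n a b) = c b"
      using nonsingular_solve(1)[OF G, of c] by (elim exE)
    have "B' ?w ?w = B' (row_act N (row_comb N r (P n)) D) ?w"
      by (rule Q.B_cong) (simp add: row_act_comb_P r row_comb_def)
    also have "\<dots> = B (row_comb N r (P n)) (row_act N ?w V)" by (rule V)
    also have "\<dots> = 0"
      by (rule P.B_zero_right) (simp add: A.row_act_comb_P c row_comb_eq_0)
    finally have "?w i = 0" if "i < N" for i using that by (rule Q.B_definite)
    then show "c a = 0" using a by (rule Q.row_comb_P_eq_0)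
  qed
  then show thesis by (rule that[OF A.intertwiner_axioms])
qed

text \<open>Nothing bounds the degrees of the coefficients of \<open>D\<close>. That
  \<open>D\<close> raises no degree follows from the expansion of \<open>u\<close> in rows of
  \<open>P m\<close>, whose images are combinations of rows of \<open>Q m\<close>.\<close>

lemma row_deg_less_row_act:
  assumes "row_deg_less N n u"
  shows "row_deg_less N n (row_act N u D)"
  unfolding row_deg_less_def
proof (intro allI impI)
  fix j k assume j: "j < N" and k: "n \<le> k"
  show "coeff (row_act N u D j) k = 0"
  proof (rule P.functional_eq_0[OF _ _ assms])
    show "row_functional N (\<lambda>u. coeff (row_act N u D j) k)"
      unfolding row_functional_def row_act_add row_act_smult
      by (auto intro!: arg_cong[of _ _ "\<lambda>f. coeff (f j) k"] row_act_cong)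
  next
    fix m a assume "m < n" "a < N"
    then show "coeff (row_act N (P m a) D j) k = 0"
      using j k Q.deg[of _ m] by (simp add: intertwines coeff_row_comb row_deg_less_def)
  qed
qed

end

section \<open>Leading coefficients and preservation of degree\<close>

lemma higher_pderiv_monom_1:
  "(pderiv ^^ i) (monom 1 n :: complex poly)
    = (if i \<le> n then monom (\<Prod>l<i. of_nat n - of_nat l) (n - i) else 0)"
proof (induction i)
  case (Suc i)
  then show ?case
    by (auto simp: pderiv_monom of_nat_diff Suc_diff_Suc mult.commute)
qed simp

text \<open>Differentiating \<open>i\<close> times and multiplying by the \<open>i\<close>-th power
  of x multiplies the \<open>n\<close>-th power by the falling factorial
  \<open>n (n - 1) ... (n - i + 1)\<close>. The products are these factorials as polynomials in
  \<open>n\<close>.\<close>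

definition leading_symbol :: "complex poly poly \<Rightarrow> complex poly" where
  "leading_symbol q = (\<Sum>i\<le>degree q. smult (coeff (coeff q i) i) (\<Prod>l<i. [:- of_nat l, 1:]))"

lemma coeff_raw_act_monom:
  "coeff (raw_act (monom 1 n) q) n = poly (leading_symbol q) (of_nat n)"
proof -
  have "coeff ((pderiv ^^ i) (monom 1 n) * f) n = coeff f i * (\<Prod>l<i. of_nat n - of_nat l)"
    for i and f :: "complex poly"
  proof (cases "i \<le> n")
    case True
    then show ?thesis by (simp add: higher_pderiv_monom_1 coeff_monom_mult)
  next
    case False
    \<comment> \<open>For \<open>i > n\<close> the falling factorial contains the factor 0, in
      agreement with the vanishing derivative.\<close>
    then have "(\<Prod>l<i. of_nat n - of_nat l :: complex) = 0"
      by (intro prod_zero) auto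
    then show ?thesis using False by (simp add: higher_pderiv_monom_1)
  qed
  then show ?thesis
    by (simp add: raw_act_def leading_symbol_def coeff_sum poly_sum poly_prod)
qed

text \<open>The determinant is a polynomial in \<open>n\<close> that is nonzero at
  \<open>n0\<close>, so it has only finitely many roots.\<close>

lemma nonsingular_poly_cofinite:
  assumes "nonsingular N (\<lambda>k j. poly (K k j) (of_nat n0))"
  shows "\<forall>\<^sub>\<infinity>n. nonsingular N (\<lambda>k j. poly (K k j) (of_nat n :: complex))"
proof -
  define \<delta> where "\<delta> = det (mat N N (\<lambda>(k, j). K k j))"
  have det: "det (mat N N (\<lambda>(k, j). poly (K k j) x)) = poly \<delta> x" for x
  proof -
    have hom: "comm_ring_hom (\<lambda>p. poly p x)" by unfold_locales auto
    have "mat N N (\<lambda>(k, j). poly (K k j) x) = map_mat (\<lambda>p. poly p x) (mat N N (\<lambda>(k, j). K k j))"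
      by (rule eq_matI) auto
    then show ?thesis by (simp add: \<delta>_def comm_ring_hom.hom_det[OF hom])
  qed
  have "\<delta> \<noteq> 0" using assms det unfolding det_nonsingular by auto
  then have "finite {x. poly \<delta> x = 0}" by (rule poly_roots_finite)
  then have "finite ((of_nat :: nat \<Rightarrow> complex) -` {x. poly \<delta> x = 0})"
    by (rule finite_vimageI) (simp add: inj_def)
  then have "\<forall>\<^sub>\<infinity>n. poly \<delta> (of_nat n) \<noteq> 0"
    by (simp add: MOST_iff_cofinite vimage_def)
  then show ?thesis unfolding det_nonsingular det .
qed

context intertwiner
begin

text \<open>The terms of \<open>u\<close> below degree \<open>n\<close> cannot contribute, as
  \<open>D\<close> raises no degree.\<close>

lemma coeff_row_act_leading:
  assumes u: "row_deg_less N (Suc n) u" and j: "j < N"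
  shows "coeff (row_act N u D j) n
    = (\<Sum>k<N. coeff (u k) n * poly (leading_symbol (D k j)) (of_nat n))"
proof -
  define l where "l k = smult (coeff (u k) n) (monom 1 n)" for k
  define v where "v k = u k - l k" for k
  have v: "row_deg_less N n v"
    unfolding row_deg_less_def
  proof (intro allI impI)
    fix k m assume "k < N" "n \<le> m"
    then show "coeff (v k) m = 0"
      using u by (cases "m = n") (auto simp: row_deg_less_def v_def l_def)
  qed
  have "u = (\<lambda>k. v k + l k)" by (rule ext) (simp add: v_def)
  then have "row_act N u D j = row_act N v D j + row_act N l D j"
    using row_act_add[of N v l D] by simp
  moreover have "coeff (row_act N v D j) n = 0"
    using row_deg_less_row_act[OF v] j by (simp add: row_deg_less_def)
  moreover have "coeff (row_act N l D j) n
      = (\<Sum>k<N. coeff (u k) n * poly (leading_symbol (D k j)) (of_nat n))"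
    by (simp add: row_act_def coeff_sum l_def raw_act_smult_left coeff_raw_act_monom)
  ultimately show ?thesis by simp
qed

text \<open>Comparing coefficients of degree \<open>n\<close> in the intertwining relation gives
  \<open>lead(P n) K = G n lead(Q n)\<close>, where \<open>K\<close> is the matrix of leading
  symbols at \<open>n\<close>. The other three factors are nonsingular.\<close>

lemma leading_symbol_nonsingular:
  assumes "nonsingular N (G n)"
  shows "nonsingular N (\<lambda>k j. poly (leading_symbol (D k j)) (of_nat n))"
  unfolding nonsingular_def
proof (intro allI impI)
  let ?K = "\<lambda>k j. poly (leading_symbol (D k j)) (of_nat n)"
  fix c a assume c: "\<forall>b<N. (\<Sum>a<N. c a * ?K a b) = 0" and a: "a < N"
  obtain r where r: "\<forall>i<N. (\<Sum>a<N. r a * coeff (P n a i) n) = c i"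
    using nonsingular_solve(1)[OF P.lead[of n], of c] by (elim exE)
  have "(\<Sum>b<N. (\<Sum>a<N. r a * G n a b) * coeff (Q n b j) n) = 0" if j: "j < N" for j
  proof -
    have "coeff (row_act N (row_comb N r (P n)) D j) n = (\<Sum>a<N. c a * ?K a j)"
      using r by (simp add: coeff_row_act_leading[OF P.row_deg_less_row_comb j] coeff_row_comb)
    also have "\<dots> = 0" using c j by simp
    finally show ?thesis by (simp add: row_act_comb_P[OF j] coeff_row_comb)
  qed
  then have "(\<Sum>a<N. r a * G n a b) = 0" if "b < N" for b
    using that by (rule nonsingularD[OF Q.lead[of n]])
  then have "r a = 0" if "a < N" for a
    using that by (rule nonsingularD[OF assms])
  then show "c a = 0" using r a by auto
qed

lemma eventually_preserves_degree:
  assumes "nonsingular N (G n0)"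
  shows "\<forall>\<^sub>\<infinity>n. \<forall>u. row_deg_less N (Suc n) u \<longrightarrow> (\<forall>j<N. coeff (row_act N u D j) n = 0) \<longrightarrow>
    (\<forall>i<N. coeff (u i) n = 0)"
  using nonsingular_poly_cofinite[OF leading_symbol_nonsingular[OF assms]]
proof (rule MOST_mono, intro allI impI)
  fix n u i
  assume K: "nonsingular N (\<lambda>k j. poly (leading_symbol (D k j)) (of_nat n))"
    and u: "row_deg_less N (Suc n) u" "\<forall>j<N. coeff (row_act N u D j) n = 0" and i: "i < N"
  show "coeff (u i) n = 0"
    using K _ i by (rule nonsingularD) (use u in \<open>simp add: coeff_row_act_leading\<close>)
qed

end

section \<open>Forms given by weight matrices\<close>

lemma integral_double_sum:
  fixes f :: "nat \<Rightarrow> nat \<Rightarrow> 'a \<Rightarrow> complex"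
  assumes "\<And>k l. k < N \<Longrightarrow> l < N \<Longrightarrow> integrable M (f k l)"
  shows "integrable M (\<lambda>x. \<Sum>k<N. \<Sum>l<N. f k l x)"
    and "(LINT x|M. (\<Sum>k<N. \<Sum>l<N. f k l x)) = (\<Sum>k<N. \<Sum>l<N. LINT x|M. f k l x)"
proof -
  have int: "integrable M (\<lambda>x. \<Sum>l<N. f k l x)" if "k < N" for k
    using assms that by (intro Bochner_Integration.integrable_sum) simp
  then show "integrable M (\<lambda>x. \<Sum>k<N. \<Sum>l<N. f k l x)"
    by (rule Bochner_Integration.integrable_sum) simp
  have "(LINT x|M. (\<Sum>l<N. f k l x)) = (\<Sum>l<N. LINT x|M. f k l x)" if "k < N" for k
    using assms that by (intro Bochner_Integration.integral_sum) simp
  then show "(LINT x|M. (\<Sum>k<N. \<Sum>l<N. f k l x)) = (\<Sum>k<N. \<Sum>l<N. LINT x|M. f k l x)"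
    using int by (subst Bochner_Integration.integral_sum) simp_all
qed

text \<open>The sums stand outside the integral, so that linearity and block decompositions can be
  checked entry by entry.\<close>

definition row_integral ::
    "ereal \<Rightarrow> ereal \<Rightarrow> nat \<Rightarrow> (real \<Rightarrow> complex mat) \<Rightarrow>
     (nat \<Rightarrow> complex poly) \<Rightarrow> (nat \<Rightarrow> complex poly) \<Rightarrow> complex" where
  "row_integral x0 x1 N W u v = (\<Sum>k<N. \<Sum>l<N. LINT x:einterval x0 x1|lborel.
     poly (u k) (of_real x) * W x $$ (k, l) * cnj (poly (v l) (of_real x)))"

definition finite_moments :: "ereal \<Rightarrow> ereal \<Rightarrow> nat \<Rightarrow> (real \<Rightarrow> complex mat) \<Rightarrow> bool" where
  "finite_moments x0 x1 N W \<longleftrightarrow> (\<forall>n. \<forall>k<N. \<forall>l<N.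
     set_integrable lborel (einterval x0 x1) (\<lambda>x. of_real (x ^ n) * W x $$ (k, l)))"

lemma set_integrable_poly_weight:
  assumes "finite_moments x0 x1 N W" "k < N" "l < N"
  shows "set_integrable lborel (einterval x0 x1)
    (\<lambda>x. poly p (of_real x) * W x $$ (k, l) * cnj (poly q (of_real x)))"
proof -
  \<comment> \<open>At real arguments the conjugate of \<open>q\<close> is the polynomial with
    conjugated coefficients, so the integrand is a polynomial times an entry of
    \<open>W\<close>.\<close>
  define r where "r = p * map_poly cnj q"
  have "poly p (of_real x) * W x $$ (k, l) * cnj (poly q (of_real x))
      = (\<Sum>i\<le>degree r. coeff r i * (of_real (x ^ i) * W x $$ (k, l)))" for x :: real
  proof -
    have "poly p (of_real x) * W x $$ (k, l) * cnj (poly q (of_real x)) = poly r (of_real x) * W x $$ (k, l)"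
      by (simp add: r_def)
    then show ?thesis
      by (simp add: poly_altdef sum_distrib_right mult.assoc)
  qed
  moreover have "set_integrable lborel (einterval x0 x1)
      (\<lambda>x. \<Sum>i\<le>degree r. coeff r i * (of_real (x ^ i) * W x $$ (k, l)))"
    unfolding set_integrable_def scaleR_sum_right
  proof (intro Bochner_Integration.integrable_sum)
    fix i
    have "set_integrable lborel (einterval x0 x1) (\<lambda>x. coeff r i * (of_real (x ^ i) * W x $$ (k, l)))"
      using assms unfolding finite_moments_def by (intro set_integrable_mult_right) blast
    then show "complex_integrable lborel
        (\<lambda>x. indicat_real (einterval x0 x1) x *\<^sub>R (coeff r i * (of_real (x ^ i) * W x $$ (k, l))))"
      unfolding set_integrable_def .
  qed
  ultimately show ?thesis by simp
qed

lemma row_functional_row_integral: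
  assumes "finite_moments x0 x1 N W"
  shows "row_functional N (\<lambda>u. row_integral x0 x1 N W u v)"
  unfolding row_functional_def
proof (intro conjI allI impI)
  let ?I = "\<lambda>p k l q. LINT x:einterval x0 x1|lborel.
    poly p (of_real x) * W x $$ (k, l) * cnj (poly q (of_real x))"
  have add: "?I (p + p') k l q = ?I p k l q + ?I p' k l q" if "k < N" "l < N" for p p' q k l
    unfolding poly_add distrib_right
    by (rule set_integral_add) (rule set_integrable_poly_weight[OF assms that])+
  have smult: "?I (smult c p) k l q = c * ?I p k l q" for p c q k l
    by (simp add: mult.assoc)
  fix u u' c
  show "row_integral x0 x1 N W (\<lambda>i. u i + u' i) v = row_integral x0 x1 N W u v + row_integral x0 x1 N W u' v"
    by (simp add: row_integral_def add sum.distrib del: poly_add)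
  show "row_integral x0 x1 N W (\<lambda>i. smult c (u i)) v = c * row_integral x0 x1 N W u v"
    by (simp only: row_integral_def smult sum_distrib_left)
  assume "\<forall>i<N. u i = u' i"
  then show "row_integral x0 x1 N W u v = row_integral x0 x1 N W u' v"
    by (simp add: row_integral_def)
qed

section \<open>Symmetry and definiteness from positivity almost everywhere\<close>

lemma pos_def_mat_cnj:
  assumes "pos_def_mat N A" "k < N" "l < N"
  shows "cnj (A $$ (k, l)) = A $$ (l, k)"
proof -
  have A: "A \<in> carrier_mat N N" "mat_adjoint A = A" using assms(1) by (auto simp: pos_def_mat_def)
  have "mat_adjoint A $$ (l, k) = cnj (A $$ (k, l))"
    using A(1) assms(2,3) by (simp add: mat_adjoint_def mat_of_rows_def conjugate_vec_def)
  then show ?thesis using A(2) by simp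
qed

lemma pos_def_mat_row:
  assumes "pos_def_mat N A" "i < N" "f i \<noteq> 0"
  shows "0 < Re (\<Sum>k<N. \<Sum>l<N. f k * A $$ (k, l) * cnj (f l))"
proof -
  \<comment> \<open>The conjugate is taken because rows act from the left here, whereas
    \<open>pos_def_mat\<close> is stated with column vectors.\<close>
  let ?v = "vec N (\<lambda>k. cnj (f k))"
  have A: "A \<in> carrier_mat N N" using assms(1) by (auto simp: pos_def_mat_def)
  have "?v $ i \<noteq> 0" using assms by simp
  then have "?v \<noteq> 0\<^sub>v N" using assms(2) by fastforce
  then have "0 < Re ((A *\<^sub>v ?v) \<bullet>c ?v)"
    using assms(1) by (simp add: pos_def_mat_def)
  also have "(A *\<^sub>v ?v) \<bullet>c ?v = (\<Sum>k<N. (\<Sum>l<N. A $$ (k, l) * cnj (f l)) * f k)"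
    using A by (auto simp: scalar_prod_def conjugate_vec_def atLeast0LessThan intro!: sum.cong)
  also have "\<dots> = (\<Sum>k<N. \<Sum>l<N. f k * A $$ (k, l) * cnj (f l))"
    by (simp add: sum_distrib_right sum_distrib_left mult_ac)
  finally show ?thesis .
qed

lemma AE_poly_nonzero:
  assumes "p \<noteq> 0"
  shows "AE x in lborel. poly p (complex_of_real x) \<noteq> 0"
proof -
  have "finite (complex_of_real -` {z. poly p z = 0})"
    by (intro finite_vimageI poly_roots_finite assms) (simp add: inj_def)
  then have "complex_of_real -` {z. poly p z = 0} \<in> null_sets lborel"
    by (rule finite_imp_null_set_lborel)
  then show ?thesis by (rule AE_I') auto
qed

lemma not_AE_outside_einterval:
  assumes "x0 < x1"
  shows "\<not> (AE x in lborel. x \<notin> einterval x0 x1)"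
proof
  assume AE: "AE x in lborel. x \<notin> einterval x0 x1"
  obtain a where a: "x0 < ereal a" "ereal a < x1" using ereal_dense2[OF assms] by blast
  obtain b where b: "ereal a < ereal b" "ereal b < x1" using ereal_dense2[OF a(2)] by blast
  have sub: "{a<..<b} \<subseteq> einterval x0 x1"
  proof
    fix x assume "x \<in> {a<..<b}"
    then have "ereal a < ereal x" "ereal x < ereal b" by auto
    then show "x \<in> einterval x0 x1"
      using a b unfolding einterval_def by (blast intro: less_trans)
  qed
  have "AE x in lborel. x \<notin> {a<..<b}"
    using AE by eventually_elim (use sub in auto)
  then have "{a<..<b} \<in> null_sets lborel" by (subst AE_iff_null_sets) auto
  then have "emeasure lborel {a<..<b} = 0" by (rule null_setsD1)
  then show False using b(1) by simp
qed

text \<open>For definiteness: a nonzero polynomial entry vanishes at finitely many points only, so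
  the integrand is positive almost everywhere on an interval of positive measure.\<close>

lemma row_form_weight:
  assumes "x0 < x1" "weight_matrix x0 x1 N W"
  shows "row_form N (row_integral x0 x1 N W)"
proof
  have fm: "finite_moments x0 x1 N W"
    using assms(2) by (auto simp: weight_matrix_def finite_moments_def)
  have pd: "AE x in lborel. x \<in> einterval x0 x1 \<longrightarrow> pos_def_mat N (W x)"
    using assms(2) by (simp add: weight_matrix_def)
  note int = set_integrable_poly_weight[OF fm, unfolded set_integrable_def]
  show "row_functional N (\<lambda>u. row_integral x0 x1 N W u v)" for v
    using fm by (rule row_functional_row_integral)
  show "row_integral x0 x1 N W v u = cnj (row_integral x0 x1 N W u v)" for u v
  proof -
    have "(LINT x:einterval x0 x1|lborel. poly (v l) (of_real x) * W x $$ (l, k) * cnj (poly (u k) (of_real x)))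
      = cnj (LINT x:einterval x0 x1|lborel. poly (u k) (of_real x) * W x $$ (k, l) * cnj (poly (v l) (of_real x)))"
      if kl: "k < N" "l < N" for k l
      \<comment> \<open>\<open>W x\<close> is known to be Hermitian only for almost every x, so the
        integrals are compared almost everywhere.\<close>
      unfolding set_lebesgue_integral_def Bochner_Integration.integral_cnj[symmetric]
    proof (rule integral_cong_AE[OF borel_measurable_integrable[OF int[OF kl(2,1), of "v l" "u k"]]
          borel_measurable_integrable[OF integrable_cnj[OF int[OF kl, of "u k" "v l"]]]])
      show "AE x in lborel. indicat_real (einterval x0 x1) x *\<^sub>R
          (poly (v l) (of_real x) * W x $$ (l, k) * cnj (poly (u k) (of_real x)))
        = cnj (indicat_real (einterval x0 x1) x *\<^sub>R
          (poly (u k) (of_real x) * W x $$ (k, l) * cnj (poly (v l) (of_real x))))"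
        using pd
      proof eventually_elim
        case (elim x)
        then show ?case
          using pos_def_mat_cnj[of N "W x" k l] kl by (auto simp: indicator_def mult_ac)
      qed
    qed
    then show ?thesis
      unfolding row_integral_def by (subst sum.swap) (simp add: cnj_sum)
  qed
  show "row_integral x0 x1 N W (X_row u) v = row_integral x0 x1 N W u (X_row v)" for u v
    by (simp add: row_integral_def mult_ac)
  show "0 < Re (row_integral x0 x1 N W u u)" if i: "i < N" "u i \<noteq> 0" for i u
  proof -
    define g where "g x = (\<Sum>k<N. \<Sum>l<N. poly (u k) (of_real x) * W x $$ (k, l) * cnj (poly (u l) (of_real x)))"
      for x :: real
    define h where "h x = indicat_real (einterval x0 x1) x *\<^sub>R g x" for x
    have h_int: "complex_integrable lborel h"
      unfolding h_def g_def scaleR_sum_right by (rule integral_double_sum(1)) (rule int)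
    have "integral\<^sup>L lborel h = row_integral x0 x1 N W u u"
      unfolding h_def g_def scaleR_sum_right row_integral_def set_lebesgue_integral_def
      by (rule integral_double_sum(2)) (rule int)
    then have Re: "Re (row_integral x0 x1 N W u u) = (LINT x|lborel. Re (h x))"
      using integral_Re[OF h_int] by simp
    have pos: "AE x in lborel. x \<in> einterval x0 x1 \<longrightarrow> 0 < Re (h x)"
      using pd AE_poly_nonzero[OF i(2)]
    proof eventually_elim
      case (elim x)
      then show ?case
        using pos_def_mat_row[of N "W x" i "\<lambda>k. poly (u k) (of_real x)"] i(1)
        by (auto simp: h_def g_def)
    qed
    have nonneg: "AE x in lborel. 0 \<le> Re (h x)"
      using pos by eventually_elim (auto simp: h_def indicator_def)
    have "(LINT x|lborel. Re (h x)) \<noteq> 0"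
    proof
      assume "(LINT x|lborel. Re (h x)) = 0"
      then have "AE x in lborel. Re (h x) = 0"
        using integral_nonneg_eq_0_iff_AE[OF integrable_Re[OF h_int] nonneg] by simp
      then have "AE x in lborel. x \<notin> einterval x0 x1"
        using pos by eventually_elim auto
      then show False using not_AE_outside_einterval[OF assms(1)] by simp
    qed
    then show ?thesis
      using integral_nonneg_AE[OF nonneg] unfolding Re by linarith
  qed
qed

lemma mat_inner_row_integral:
  assumes "P \<in> carrier_mat N N" "Q \<in> carrier_mat N N" "a < N" "b < N"
    and "finite_moments x0 x1 N W" "\<And>x. x \<in> einterval x0 x1 \<Longrightarrow> W x \<in> carrier_mat N N"
  shows "mat_inner x0 x1 N W P Q $$ (a, b)
    = row_integral x0 x1 N W (\<lambda>k. P $$ (a, k)) (\<lambda>l. Q $$ (b, l))"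
proof -
  have entry: "(eval_mat P x * W x * mat_adjoint (eval_mat Q x)) $$ (a, b)
      = (\<Sum>k<N. \<Sum>l<N. poly (P $$ (a, k)) (of_real x) * W x $$ (k, l) * cnj (poly (Q $$ (b, l)) (of_real x)))"
    if "x \<in> einterval x0 x1" for x
  proof -
    have W: "W x \<in> carrier_mat N N" using assms(6) that .
    have adj: "mat_adjoint (eval_mat Q x) $$ (l, b) = cnj (poly (Q $$ (b, l)) (of_real x))"
      if "l < N" for l
      using assms(2,4) that
      by (simp add: mat_adjoint_def mat_of_rows_def conjugate_vec_def eval_mat_def)
    have adjc: "mat_adjoint (eval_mat Q x) \<in> carrier_mat N N"
      using assms(2) by (auto simp: mat_adjoint_def mat_of_rows_def eval_mat_def)
    have P: "eval_mat P x \<in> carrier_mat N N" using assms(1) by (simp add: eval_mat_def)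
    have "(eval_mat P x * W x * mat_adjoint (eval_mat Q x)) $$ (a, b)
        = (\<Sum>l<N. (\<Sum>k<N. eval_mat P x $$ (a, k) * W x $$ (k, l)) * mat_adjoint (eval_mat Q x) $$ (l, b))"
      unfolding mult_mat_entry[OF mult_carrier_mat[OF P W] adjc assms(3,4)]
      by (intro sum.cong refl) (simp add: mult_mat_entry[OF P W assms(3)])
    also have "\<dots> = (\<Sum>l<N. (\<Sum>k<N. poly (P $$ (a, k)) (of_real x) * W x $$ (k, l)) * cnj (poly (Q $$ (b, l)) (of_real x)))"
    proof -
      have "eval_mat P x $$ (a, k) = poly (P $$ (a, k)) (of_real x)" if "k < N" for k
        using assms(1,3) that by (simp add: eval_mat_def)
      then show ?thesis by (simp add: adj)
    qed
    also have "\<dots> = (\<Sum>k<N. \<Sum>l<N. poly (P $$ (a, k)) (of_real x) * W x $$ (k, l) * cnj (poly (Q $$ (b, l)) (of_real x)))"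
      by (subst sum.swap) (simp add: sum_distrib_right)
    finally show ?thesis .
  qed
  have "mat_inner x0 x1 N W P Q $$ (a, b) = (LINT x:einterval x0 x1|lborel.
      (\<Sum>k<N. \<Sum>l<N. poly (P $$ (a, k)) (of_real x) * W x $$ (k, l) * cnj (poly (Q $$ (b, l)) (of_real x))))"
    using assms(3,4) entry
    by (auto simp: mat_inner_def mat_integral_def intro!: set_lebesgue_integral_cong)
  also have "\<dots> = row_integral x0 x1 N W (\<lambda>k. P $$ (a, k)) (\<lambda>l. Q $$ (b, l))"
    unfolding row_integral_def set_lebesgue_integral_def scaleR_sum_right
    by (rule integral_double_sum(2)) (rule set_integrable_poly_weight[OF assms(5), unfolded set_integrable_def])
  finally show ?thesis .
qed

text \<open>Upper bounds are insensitive to the value 0 that \<open>mat_degree\<close> inserts into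
  the maximum.\<close>

lemma mat_degree_le_iff:
  assumes "P \<in> carrier_mat N N"
  shows "mat_degree P \<le> n \<longleftrightarrow> (\<forall>a<N. row_deg_less N (Suc n) (\<lambda>i. P $$ (a, i)))"
proof -
  have fin: "finite (elements_mat P)" by (simp add: elements_mat_def)
  have el: "elements_mat P = {P $$ (a, i) | a i. a < N \<and> i < N}"
    using assms by (auto simp: elements_mat_def) blast
  have "degree p \<le> n \<longleftrightarrow> (\<forall>k\<ge>Suc n. coeff p k = 0)" for p :: "complex poly"
    by (auto simp: Suc_le_eq intro: degree_le coeff_eq_0)
  then show ?thesis
    using fin by (auto simp: mat_degree_def el row_deg_less_def)
qed

lemma orth_rows_orthogonal_polys:
  assumes B: "row_form N (row_integral x0 x1 N W)" and P: "orthogonal_polys x0 x1 N W P"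
    and "finite_moments x0 x1 N W" "\<And>x. x \<in> einterval x0 x1 \<Longrightarrow> W x \<in> carrier_mat N N"
  shows "orth_rows N (row_integral x0 x1 N W) (\<lambda>n a i. P n $$ (a, i))"
proof -
  interpret row_form N "row_integral x0 x1 N W" by fact
  have P': "P n \<in> carrier_mat N N" "mat_degree (P n) = n" "invertible_mat (lead_coeff_mat (P n))" for n
    using P by (auto simp: orthogonal_polys_def)
  show ?thesis
  proof
    show "row_deg_less N (Suc n) (\<lambda>i. P n $$ (a, i))" if "a < N" for a n
      using mat_degree_le_iff[OF P'(1), of n n] P'(2)[of n] that by simp
    show "nonsingular N (\<lambda>a i. coeff (P n $$ (a, i)) n)" for n
    proof -
      have L: "lead_coeff_mat (P n) \<in> carrier_mat N N" using P'(1) by (simp add: lead_coeff_mat_def)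
      have "nonsingular N (\<lambda>a i. lead_coeff_mat (P n) $$ (a, i))
          \<longleftrightarrow> nonsingular N (\<lambda>a i. coeff (P n $$ (a, i)) n)"
        using P'(1)[of n] P'(2)[of n] by (intro nonsingular_cong) (simp add: lead_coeff_mat_def)
      then show ?thesis
        using P'(3)[of n] invertible_mat_nonsingular[OF L] by simp
    qed
    show "row_integral x0 x1 N W (\<lambda>i. P n $$ (a, i)) (\<lambda>i. P m $$ (b, i)) = 0"
      if "n \<noteq> m" "a < N" "b < N" for n m a b
      using mat_inner_row_integral[OF P'(1)[of n] P'(1)[of m] that(2,3) assms(3,4)] P that
      by (simp add: orthogonal_polys_def)
  qed
qed

section \<open>Direct sums\<close>

text \<open>Global index of the first entry of block \<open>j\<close>: blocks are numbered from 1,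
  rows and columns from 0.\<close>

definition block_offset :: "(nat \<Rightarrow> nat) \<Rightarrow> nat \<Rightarrow> nat" where
  "block_offset d j = (\<Sum>i=1..<j. d i)"

lemma block_offset_less:
  assumes "j \<in> {1..M}" "b < d j"
  shows "block_offset d j + b < (\<Sum>j=1..M. d j)"
proof -
  have "{1..j} = insert j {1..<j}" using assms(1) by auto
  then have "block_offset d j + d j = (\<Sum>i=1..j. d i)"
    by (simp add: block_offset_def)
  also have "\<dots> \<le> (\<Sum>i=1..M. d i)" using assms(1) by (intro sum_mono2) auto
  finally show ?thesis using assms(2) by simp
qed

lemma block_cases:
  assumes "k < (\<Sum>j=1..M. d j)"
  obtains j b where "j \<in> {1..M}" "b < d j" "k = block_offset d j + b"
  using assms
proof (induction M arbitrary: thesis)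
  case (Suc M)
  show ?case
  proof (cases "k < (\<Sum>j=1..M. d j)")
    case True
    show ?thesis
    proof (rule Suc.IH[OF _ True])
      fix j b assume "j \<in> {1..M}" "b < d j" "k = block_offset d j + b"
      then show thesis by (intro Suc.prems(1)) simp_all
    qed
  next
    case False
    then show ?thesis
      using Suc.prems(1)[of "Suc M" "k - (\<Sum>j=1..M. d j)"] Suc.prems(2)
      by (simp add: block_offset_def atLeastLessThanSuc_atLeastAtMost)
  qed
qed simp

lemma sum_lessThan_add:
  "(\<Sum>k<m + n. f k) = (\<Sum>k<m. f k) + (\<Sum>k<n. f (m + k))"
  for f :: "nat \<Rightarrow> 'a :: comm_monoid_add"
  by (induction n) (simp_all add: ac_simps)

lemma sum_blocks:
  "(\<Sum>k<(\<Sum>j=1..M. d j). f k) = (\<Sum>j=1..M. \<Sum>b<d j. f (block_offset d j + b))"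
  for f :: "nat \<Rightarrow> 'a :: comm_monoid_add"
  by (induction M)
     (simp_all add: sum_lessThan_add block_offset_def atLeastLessThanSuc_atLeastAtMost)

section \<open>Entries of block diagonal and side-by-side matrices\<close>

lemma sum_list_take_less:
  "i < length xs \<Longrightarrow> a < xs ! i \<Longrightarrow> sum_list (take i xs) + a < sum_list xs"
  for a :: nat
proof (induction xs arbitrary: i)
  case (Cons x xs)
  then show ?case by (cases i) auto
qed simp

lemma diag_block_mat_index:
  assumes "i < length As" "j < length As" "a < dim_row (As ! i)" "b < dim_col (As ! j)"
  shows "diag_block_mat As $$ (sum_list (take i (map dim_row As)) + a, sum_list (take j (map dim_col As)) + b)
    = (if i = j then As ! i $$ (a, b) else 0)"
  using assms
proof (induction As arbitrary: i j)
  case (Cons A As)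
  let ?D = "diag_block_mat As"
  have r: "sum_list (take i (map dim_row As)) + a < dim_row ?D"
    if "i < length As" "a < dim_row (As ! i)" for i
    using sum_list_take_less[of i "map dim_row As" a] that by (simp add: dim_diag_block_mat)
  have c: "sum_list (take j (map dim_col As)) + b < dim_col ?D"
    if "j < length As" "b < dim_col (As ! j)" for j
    using sum_list_take_less[of j "map dim_col As" b] that by (simp add: dim_diag_block_mat)
  show ?case
    using Cons.prems r c Cons.IH[of "i - 1" "j - 1"]
    by (cases i; cases j) (auto simp: Let_def add.assoc)
qed simp

lemma concat_nth_block:
  assumes "j < length xss" "b < length (xss ! j)"
  shows "concat xss ! (sum_list (take j (map length xss)) + b) = xss ! j ! b"
  using assms
proof (induction xss arbitrary: j)
  case (Cons xs xss)
  then show ?case by (cases j) (auto simp: nth_append add.assoc)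
qed simp

lemma sum_list_take_blocks:
  assumes "\<And>j. j \<in> {1..M} \<Longrightarrow> f (F j) = d j" "j \<in> {1..M}"
  shows "sum_list (take (j - 1) (map f (map F [1..<Suc M]))) = block_offset d j"
proof -
  \<comment> \<open>Lists count from 0 and blocks from 1, so block \<open>j\<close> is preceded by
    \<open>j - 1\<close> list elements.\<close>
  have "take (j - 1) [1..<Suc M] = [1..<j]"
    using assms(2) by (simp add: take_upt del: upt_Suc)
  then have "sum_list (take (j - 1) (map f (map F [1..<Suc M]))) = sum_list (map (\<lambda>j. f (F j)) [1..<j])"
    by (simp add: take_map o_def del: upt_Suc)
  also have "\<dots> = (\<Sum>i=1..<j. f (F i))"
    by (simp add: interv_sum_list_conv_sum_set_nat)
  also have "\<dots> = block_offset d j"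
    unfolding block_offset_def using assms by (intro sum.cong) auto
  finally show ?thesis .
qed

lemma sum_list_blocks:
  assumes "\<And>j. j \<in> {1..M} \<Longrightarrow> f (F j) = d j"
  shows "sum_list (map f (map F [1..<Suc M])) = (\<Sum>j=1..M. d j)"
proof -
  have "sum_list (map f (map F [1..<Suc M])) = (\<Sum>i=1..<Suc M. f (F i))"
    by (simp add: interv_sum_list_conv_sum_set_nat o_def del: upt_Suc)
  also have "\<dots> = (\<Sum>j=1..M. d j)"
    unfolding atLeastLessThanSuc_atLeastAtMost using assms by (intro sum.cong) auto
  finally show ?thesis .
qed

lemma mat_direct_sum_carrier:
  assumes "\<And>j. j \<in> {1..M} \<Longrightarrow> F j \<in> carrier_mat (d j) (d j)"
  shows "mat_direct_sum M F \<in> carrier_mat (\<Sum>j=1..M. d j) (\<Sum>j=1..M. d j)"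
proof -
  have "sum_list (map dim_row (map F [1..<Suc M])) = (\<Sum>j=1..M. d j)"
    by (rule sum_list_blocks) (use assms in blast)
  moreover have "sum_list (map dim_col (map F [1..<Suc M])) = (\<Sum>j=1..M. d j)"
    by (rule sum_list_blocks) (use assms in blast)
  ultimately show ?thesis
    unfolding mat_direct_sum_def by (intro carrier_matI) (simp_all only: dim_diag_block_mat)
qed

lemma mat_direct_sum_index:
  assumes "\<And>j. j \<in> {1..M} \<Longrightarrow> F j \<in> carrier_mat (d j) (d j)"
    and "i \<in> {1..M}" "j \<in> {1..M}" "a < d i" "b < d j"
  shows "mat_direct_sum M F $$ (block_offset d i + a, block_offset d j + b)
    = (if i = j then F i $$ (a, b) else 0)"
proof -
  let ?As = "map F [1..<Suc M]"
  have nth: "?As ! (i - 1) = F i" if "i \<in> {1..M}" for i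
    using that nth_map[of "i - 1" "[1..<Suc M]" F] nth_upt[of 1 "i - 1" "Suc M"]
    by (auto simp del: upt_Suc)
  have dims: "dim_row (F j) = d j" "dim_col (F j) = d j" if "j \<in> {1..M}" for j
    using assms(1)[OF that] by auto
  have "diag_block_mat ?As $$ (sum_list (take (i - 1) (map dim_row ?As)) + a, sum_list (take (j - 1) (map dim_col ?As)) + b)
      = (if i - 1 = j - 1 then ?As ! (i - 1) $$ (a, b) else 0)"
    using assms(2-5) dims by (intro diag_block_mat_index) (auto simp: nth simp del: upt_Suc)
  moreover have "sum_list (take (i - 1) (map dim_row ?As)) = block_offset d i"
    using dims(1) assms(2) by (rule sum_list_take_blocks)
  moreover have "sum_list (take (j - 1) (map dim_col ?As)) = block_offset d j"
    using dims(2) assms(3) by (rule sum_list_take_blocks)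
  moreover have "i - 1 = j - 1 \<longleftrightarrow> i = j" using assms(2,3) by auto
  ultimately show ?thesis
    unfolding mat_direct_sum_def by (simp only: nth[OF assms(2)])
qed

lemma side_by_side_carrier:
  assumes "\<And>j. j \<in> {1..M} \<Longrightarrow> F j \<in> carrier_mat N (d j)"
  shows "side_by_side N M F \<in> carrier_mat N (\<Sum>j=1..M. d j)"
proof -
  have "sum_list (map length (map (\<lambda>j. cols (F j)) [1..<Suc M])) = (\<Sum>j=1..M. d j)"
    by (rule sum_list_blocks) (use assms in force)
  then show ?thesis by (simp add: side_by_side_def mat_of_cols_def length_concat del: upt_Suc)
qed

lemma side_by_side_index:
  assumes "\<And>j. j \<in> {1..M} \<Longrightarrow> F j \<in> carrier_mat N (d j)"
    and "j \<in> {1..M}" "a < N" "b < d j"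
  shows "side_by_side N M F $$ (a, block_offset d j + b) = F j $$ (a, b)"
proof -
  let ?C = "map (\<lambda>j. cols (F j)) [1..<Suc M]"
  have dims: "length (cols (F j)) = d j" if "j \<in> {1..M}" for j
    using assms(1)[OF that] by auto
  have F: "F j \<in> carrier_mat N (d j)" using assms(1,2) by blast
  have nth: "?C ! (j - 1) = cols (F j)"
    using assms(2) nth_map[of "j - 1" "[1..<Suc M]" "\<lambda>j. cols (F j)"] nth_upt[of 1 "j - 1" "Suc M"]
    by (auto simp del: upt_Suc)
  have "sum_list (map length ?C) = (\<Sum>j=1..M. d j)"
    using dims by (rule sum_list_blocks)
  then have len: "block_offset d j + b < length (concat ?C)"
    using block_offset_less[of j M b d] assms(2,4) by (simp add: length_concat del: upt_Suc)
  have "concat ?C ! (sum_list (take (j - 1) (map length ?C)) + b) = ?C ! (j - 1) ! b"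
    using assms(2,4) dims[OF assms(2)] by (intro concat_nth_block) (auto simp: nth simp del: upt_Suc)
  moreover have "sum_list (take (j - 1) (map length ?C)) = block_offset d j"
    using dims assms(2) by (rule sum_list_take_blocks)
  ultimately have "concat ?C ! (block_offset d j + b) = cols (F j) ! b"
    by (simp only: nth)
  then have "concat ?C ! (block_offset d j + b) = col (F j) b"
    using F assms(4) by (simp del: upt_Suc)
  then show ?thesis
    using len assms(3,4) F by (simp add: side_by_side_def mat_of_cols_def del: upt_Suc)
qed

section \<open>Forms and orthogonal rows on direct sums\<close>

definition row_block :: "(nat \<Rightarrow> nat) \<Rightarrow> nat \<Rightarrow> (nat \<Rightarrow> complex poly) \<Rightarrow> nat \<Rightarrow> complex poly" where
  "row_block d j u = (\<lambda>b. u (block_offset d j + b))"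

lemma row_form_blocks:
  assumes "\<And>j. j \<in> {1..M} \<Longrightarrow> row_form (d j) (B j)"
  shows "row_form (\<Sum>j=1..M. d j) (\<lambda>u v. \<Sum>j=1..M. B j (row_block d j u) (row_block d j v))"
proof
  note B = assms
  show "row_functional (\<Sum>j=1..M. d j) (\<lambda>u. \<Sum>j=1..M. B j (row_block d j u) (row_block d j v))" for v
    unfolding row_functional_def
  proof (intro conjI allI impI)
    fix u u' c
    show "(\<Sum>j=1..M. B j (row_block d j (\<lambda>i. u i + u' i)) (row_block d j v))
      = (\<Sum>j=1..M. B j (row_block d j u) (row_block d j v)) + (\<Sum>j=1..M. B j (row_block d j u') (row_block d j v))"
      unfolding sum.distrib[symmetric] row_block_def
      by (intro sum.cong refl row_form.B_add[OF B])
    show "(\<Sum>j=1..M. B j (row_block d j (\<lambda>i. smult c (u i))) (row_block d j v))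
      = c * (\<Sum>j=1..M. B j (row_block d j u) (row_block d j v))"
      unfolding sum_distrib_left row_block_def
      by (intro sum.cong refl row_form.B_smult[OF B])
    assume u: "\<forall>i<\<Sum>j=1..M. d j. u i = u' i"
    show "(\<Sum>j=1..M. B j (row_block d j u) (row_block d j v))
      = (\<Sum>j=1..M. B j (row_block d j u') (row_block d j v))"
    proof (intro sum.cong refl row_form.B_cong[OF B])
      fix j i assume "j \<in> {1..M}" "i < d j"
      then show "row_block d j u i = row_block d j u' i"
        using u block_offset_less[of j M i d] by (simp add: row_block_def)
    qed
  qed
  show "(\<Sum>j=1..M. B j (row_block d j v) (row_block d j u))
    = cnj (\<Sum>j=1..M. B j (row_block d j u) (row_block d j v))" for u v
    unfolding cnj_sum by (intro sum.cong refl row_form.hermitian[OF B])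
  show "(\<Sum>j=1..M. B j (row_block d j (X_row u)) (row_block d j v))
    = (\<Sum>j=1..M. B j (row_block d j u) (row_block d j (X_row v)))" for u v
    unfolding row_block_def by (intro sum.cong refl row_form.X_symmetric[OF B])
  show "0 < Re (\<Sum>j=1..M. B j (row_block d j u) (row_block d j u))"
    if k: "k < (\<Sum>j=1..M. d j)" "u k \<noteq> 0" for k u
  proof -
    \<comment> \<open>Every block contributes a nonnegative term, and a block that contains a
      nonzero entry a positive one.\<close>
    have nonneg: "0 \<le> Re (B j (row_block d j u) (row_block d j u))" if j: "j \<in> {1..M}" for j
    proof (cases "\<exists>i<d j. row_block d j u i \<noteq> 0")
      case True
      then show ?thesis using row_form.definite[OF B[OF j]] by (auto intro: less_imp_le)
    next
      case False
      then show ?thesis using row_form.B_zero[OF B[OF j], of "row_block d j u"] by simp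
    qed
    from k(1) obtain j b where j: "j \<in> {1..M}" "b < d j" "k = block_offset d j + b"
      by (rule block_cases)
    have "0 < Re (B j (row_block d j u) (row_block d j u))"
      using row_form.definite[OF B[OF j(1)] j(2), of "row_block d j u"] k(2) j(3)
      by (simp add: row_block_def)
    then show ?thesis
      unfolding Re_sum using j(1) nonneg by (intro sum_pos2[of _ j]) auto
  qed
qed

text \<open>A row of \<open>Q n\<close> is nonzero in a single block only, so each requirement
  reduces to the corresponding one for that \<open>p j\<close>.\<close>

lemma orth_rows_blocks:
  assumes p: "\<And>j. j \<in> {1..M} \<Longrightarrow> orth_rows (d j) (B j) (p j)"
    and Q: "\<And>n i j a b. i \<in> {1..M} \<Longrightarrow> j \<in> {1..M} \<Longrightarrow> a < d i \<Longrightarrow> b < d j \<Longrightarrow>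
      Q n (block_offset d i + a) (block_offset d j + b) = (if i = j then p i n a b else 0)"
  shows "orth_rows (\<Sum>j=1..M. d j) (\<lambda>u v. \<Sum>j=1..M. B j (row_block d j u) (row_block d j v)) Q"
proof -
  have B: "row_form (d j) (B j)" if "j \<in> {1..M}" for j
    using p[OF that] by (rule orth_rows.axioms)
  interpret row_form "\<Sum>j=1..M. d j" "\<lambda>u v. \<Sum>j=1..M. B j (row_block d j u) (row_block d j v)"
    using B by (rule row_form_blocks)
  show ?thesis
  proof
    fix n k assume "k < (\<Sum>j=1..M. d j)"
    then obtain i a where i: "i \<in> {1..M}" "a < d i" "k = block_offset d i + a" by (rule block_cases)
    show "row_deg_less (\<Sum>j=1..M. d j) (Suc n) (Q n k)"
      unfolding row_deg_less_def
    proof (intro allI impI)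
      fix l m assume l: "l < (\<Sum>j=1..M. d j)" and m: "Suc n \<le> m"
      from l obtain j b where j: "j \<in> {1..M}" "b < d j" "l = block_offset d j + b" by (rule block_cases)
      show "coeff (Q n k l) m = 0"
        using Q[OF i(1) j(1) i(2) j(2)] orth_rows.deg[OF p[OF i(1)] i(2), of n] m i j
        by (auto simp: row_deg_less_def)
    qed
  next
    fix n
    show "nonsingular (\<Sum>j=1..M. d j) (\<lambda>k l. coeff (Q n k l) n)"
      unfolding nonsingular_def
    proof (intro allI impI)
      fix c k assume c: "\<forall>l<\<Sum>j=1..M. d j. (\<Sum>k<\<Sum>j=1..M. d j. c k * coeff (Q n k l) n) = 0"
        and k: "k < (\<Sum>j=1..M. d j)"
      from k obtain j a where j: "j \<in> {1..M}" "a < d j" "k = block_offset d j + a" by (rule block_cases)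
      have "c (block_offset d j + a) = 0"
      proof (rule nonsingularD[OF orth_rows.lead[OF p[OF j(1)], of n] _ j(2)])
        fix b assume b: "b < d j"
        have "0 = (\<Sum>k<\<Sum>j=1..M. d j. c k * coeff (Q n k (block_offset d j + b)) n)"
          using c block_offset_less[of j M b d] j(1) b by simp
        also have "\<dots> = (\<Sum>i=1..M. if i = j then \<Sum>a<d j. c (block_offset d j + a) * coeff (p j n a b) n else 0)"
          unfolding sum_blocks using Q[OF _ j(1) _ b] by (intro sum.cong refl) auto
        also have "\<dots> = (\<Sum>a<d j. c (block_offset d j + a) * coeff (p j n a b) n)"
          using j(1) by simp
        finally show "(\<Sum>a<d j. c (block_offset d j + a) * coeff (p j n a b) n) = 0" by simp
      qed
      then show "c k = 0" using j by simp
    qed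
  next
    fix n m k l :: nat assume nm: "n \<noteq> m" and kl: "k < (\<Sum>j=1..M. d j)" "l < (\<Sum>j=1..M. d j)"
    from kl(1) obtain i a where i: "i \<in> {1..M}" "a < d i" "k = block_offset d i + a"
      by (rule block_cases)
    from kl(2) obtain i' a' where i': "i' \<in> {1..M}" "a' < d i'" "l = block_offset d i' + a'"
      by (rule block_cases)
    show "(\<Sum>j=1..M. B j (row_block d j (Q n k)) (row_block d j (Q m l))) = 0"
    proof (intro sum.neutral ballI)
      fix j assume j: "j \<in> {1..M}"
      interpret p: orth_rows "d j" "B j" "p j" using p j .
      have e: "row_block d j (Q n k) b = (if i = j then p i n a b else 0)"
        "row_block d j (Q m l) b = (if i' = j then p i' m a' b else 0)" if "b < d j" for b
        using Q[OF i(1) j i(2) that] Q[OF i'(1) j i'(2) that] i(3) i'(3) by (simp_all add: row_block_def)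
      show "B j (row_block d j (Q n k)) (row_block d j (Q m l)) = 0"
      proof (cases "i = j \<and> i' = j")
        case True
        have "B j (row_block d j (Q n k)) (row_block d j (Q m l)) = B j (p j n a) (row_block d j (Q m l))"
          by (rule p.B_cong) (use e True in simp)
        also have "\<dots> = B j (p j n a) (p j m a')"
          by (rule p.B_cong_right) (use e True in simp)
        finally show ?thesis using p.orth[OF nm] i(2) i'(2) True by simp
      next
        case False
        then consider "i \<noteq> j" | "i' \<noteq> j" by blast
        then show ?thesis
        proof cases
          case 1
          then show ?thesis by (intro p.B_zero) (simp add: e)
        next
          case 2
          then show ?thesis by (intro p.B_zero_right) (simp add: e)
        qed
      qed
    qed
  qed
qed

lemma finite_moments_direct_sum:
  assumes "\<And>j. j \<in> {1..M} \<Longrightarrow> finite_moments x0 x1 (d j) (w j)"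
    and w: "\<And>j x. j \<in> {1..M} \<Longrightarrow> x \<in> einterval x0 x1 \<Longrightarrow> w j x \<in> carrier_mat (d j) (d j)"
  shows "finite_moments x0 x1 (\<Sum>j=1..M. d j) (\<lambda>x. mat_direct_sum M (\<lambda>j. w j x))"
  unfolding finite_moments_def
proof (intro allI impI)
  fix n k l assume kl: "k < (\<Sum>j=1..M. d j)" "l < (\<Sum>j=1..M. d j)"
  from kl(1) obtain i a where i: "i \<in> {1..M}" "a < d i" "k = block_offset d i + a"
    by (rule block_cases)
  from kl(2) obtain j b where j: "j \<in> {1..M}" "b < d j" "l = block_offset d j + b"
    by (rule block_cases)
  have "set_integrable lborel (einterval x0 x1) (\<lambda>x. of_real (x ^ n) * mat_direct_sum M (\<lambda>j. w j x) $$ (k, l))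
    \<longleftrightarrow> set_integrable lborel (einterval x0 x1)
      (\<lambda>x. if i = j then of_real (x ^ n) * w i x $$ (a, b) else 0)"
  proof (rule set_integrable_cong[OF refl refl])
    fix x assume x: "x \<in> einterval x0 x1"
    have "mat_direct_sum M (\<lambda>j. w j x) $$ (k, l) = (if i = j then w i x $$ (a, b) else 0)"
      unfolding i(3) j(3) using w[OF _ x] i(1) j(1) i(2) j(2) by (rule mat_direct_sum_index)
    then show "of_real (x ^ n) * mat_direct_sum M (\<lambda>j. w j x) $$ (k, l)
        = (if i = j then of_real (x ^ n) * w i x $$ (a, b) else 0)" by simp
  qed
  moreover have "set_integrable lborel (einterval x0 x1) (\<lambda>x. if i = j then of_real (x ^ n) * w i x $$ (a, b) else 0)"
    using assms(1)[OF i(1)] i(2) j(2) by (cases "i = j") (auto simp: finite_moments_def set_integrable_def)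
  ultimately show "set_integrable lborel (einterval x0 x1)
      (\<lambda>x. of_real (x ^ n) * mat_direct_sum M (\<lambda>j. w j x) $$ (k, l))" by simp
qed

lemma row_integral_direct_sum:
  assumes w: "\<And>j x. j \<in> {1..M} \<Longrightarrow> x \<in> einterval x0 x1 \<Longrightarrow> w j x \<in> carrier_mat (d j) (d j)"
  shows "row_integral x0 x1 (\<Sum>j=1..M. d j) (\<lambda>x. mat_direct_sum M (\<lambda>j. w j x)) u v
    = (\<Sum>j=1..M. row_integral x0 x1 (d j) (w j) (row_block d j u) (row_block d j v))"
proof -
  let ?I = "\<lambda>j a b. LINT x:einterval x0 x1|lborel. poly (row_block d j u a) (of_real x) *
    w j x $$ (a, b) * cnj (poly (row_block d j v b) (of_real x))"
  have entry: "(LINT x:einterval x0 x1|lborel. poly (u (block_offset d i + a)) (of_real x) *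
      mat_direct_sum M (\<lambda>j. w j x) $$ (block_offset d i + a, block_offset d j + b) *
      cnj (poly (v (block_offset d j + b)) (of_real x))) = (if j = i then ?I i a b else 0)"
    if ij: "i \<in> {1..M}" "j \<in> {1..M}" "a < d i" "b < d j" for i j a b
  proof -
    have "(LINT x:einterval x0 x1|lborel. poly (u (block_offset d i + a)) (of_real x) *
        mat_direct_sum M (\<lambda>j. w j x) $$ (block_offset d i + a, block_offset d j + b) *
        cnj (poly (v (block_offset d j + b)) (of_real x)))
      = (LINT x:einterval x0 x1|lborel. if j = i then poly (row_block d i u a) (of_real x) *
          w i x $$ (a, b) * cnj (poly (row_block d i v b) (of_real x)) else 0)"
    proof (rule set_lebesgue_integral_cong, simp, intro allI impI)
      fix x assume x: "x \<in> einterval x0 x1"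
      have "mat_direct_sum M (\<lambda>j. w j x) $$ (block_offset d i + a, block_offset d j + b)
          = (if i = j then w i x $$ (a, b) else 0)"
        using w[OF _ x] ij by (rule mat_direct_sum_index)
      then show "poly (u (block_offset d i + a)) (of_real x) *
          mat_direct_sum M (\<lambda>j. w j x) $$ (block_offset d i + a, block_offset d j + b) *
          cnj (poly (v (block_offset d j + b)) (of_real x))
        = (if j = i then poly (row_block d i u a) (of_real x) *
          w i x $$ (a, b) * cnj (poly (row_block d i v b) (of_real x)) else 0)"
        by (simp add: row_block_def)
    qed
    then show ?thesis by (cases "j = i") (simp_all add: set_lebesgue_integral_def)
  qed
  have "row_integral x0 x1 (\<Sum>j=1..M. d j) (\<lambda>x. mat_direct_sum M (\<lambda>j. w j x)) u v
    = (\<Sum>i=1..M. \<Sum>a<d i. \<Sum>j=1..M. \<Sum>b<d j. if j = i then ?I i a b else 0)"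
    unfolding row_integral_def sum_blocks by (intro sum.cong refl entry) simp_all
  also have "\<dots> = (\<Sum>i=1..M. \<Sum>a<d i. \<Sum>b<d i. ?I i a b)"
  proof (rule sum.cong[OF refl], rule sum.cong[OF refl])
    fix i a assume i: "i \<in> {1..M}"
    have "(\<Sum>j=1..M. \<Sum>b<d j. if j = i then ?I i a b else 0)
      = (\<Sum>j=1..M. if j = i then \<Sum>b<d i. ?I i a b else 0)"
      by (rule sum.cong[OF refl]) simp
    also have "\<dots> = (\<Sum>b<d i. ?I i a b)"
      unfolding sum.delta[OF finite_atLeastAtMost] using i by (simp only: if_True)
    finally show "(\<Sum>j=1..M. \<Sum>b<d j. if j = i then ?I i a b else 0) = (\<Sum>b<d i. ?I i a b)" .
  qed
  finally show ?thesis unfolding row_integral_def .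
qed

section \<open>Matrix polynomials\<close>

abbreviation mat_rows :: "'a mat \<Rightarrow> nat \<Rightarrow> nat \<Rightarrow> 'a" where
  "mat_rows A \<equiv> (\<lambda>a i. A $$ (a, i))"

abbreviation op_entries :: "weyl mat \<Rightarrow> nat \<Rightarrow> nat \<Rightarrow> complex poly poly" where
  "op_entries D \<equiv> (\<lambda>k j. weyl_poly (D $$ (k, j)))"

lemma mat_act_carrier:
  "P \<in> carrier_mat r N \<Longrightarrow> D \<in> carrier_mat N c \<Longrightarrow> mat_act P D \<in> carrier_mat r c"
  by (auto simp: mat_act_def)

lemma mat_act_index:
  assumes "P \<in> carrier_mat r N" "D \<in> carrier_mat N c" "a < r" "j < c"
  shows "mat_act P D $$ (a, j) = row_act N (mat_rows P a) (op_entries D) j"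
  using assms by (simp add: mat_act_def row_act_def dop_act_raw)

lemma const_mat_mult_carrier:
  "A \<in> carrier_mat r n \<Longrightarrow> Q \<in> carrier_mat n c \<Longrightarrow> const_mat A * Q \<in> carrier_mat r c"
  by (auto simp: const_mat_def)

lemma const_mat_mult_index:
  assumes "A \<in> carrier_mat r n" "Q \<in> carrier_mat n c" "a < r" "j < c"
  shows "(const_mat A * Q) $$ (a, j) = row_comb n (mat_rows A a) (mat_rows Q) j"
proof -
  have "const_mat A \<in> carrier_mat r n" using assms(1) by (simp add: const_mat_def)
  then have "(const_mat A * Q) $$ (a, j) = (\<Sum>k<n. const_mat A $$ (a, k) * Q $$ (k, j))"
    using assms by (intro mult_mat_entry)
  also have "\<dots> = row_comb n (mat_rows A a) (mat_rows Q) j"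
    using assms(1,3) unfolding row_comb_def by (intro sum.cong) (auto simp: const_mat_def)
  finally show ?thesis .
qed

lemma mat_eq_entries_iff:
  assumes "X \<in> carrier_mat r c" "Y \<in> carrier_mat r c"
  shows "X = Y \<longleftrightarrow> (\<forall>a<r. \<forall>j<c. X $$ (a, j) = Y $$ (a, j))"
  using assms by (auto intro: eq_matI)

text \<open>Passage between matrix identities and the row identities of the locales.\<close>

lemma mat_act_eq_iff:
  assumes "P \<in> carrier_mat r N" "D \<in> carrier_mat N c" "A \<in> carrier_mat r n" "Q \<in> carrier_mat n c"
  shows "mat_act P D = const_mat A * Q \<longleftrightarrow>
    (\<forall>a<r. \<forall>j<c. row_act N (mat_rows P a) (op_entries D) j = row_comb n (mat_rows A a) (mat_rows Q) j)"
proof -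
  have "mat_act P D = const_mat A * Q \<longleftrightarrow>
    (\<forall>a<r. \<forall>j<c. mat_act P D $$ (a, j) = (const_mat A * Q) $$ (a, j))"
    by (rule mat_eq_entries_iff[OF mat_act_carrier[OF assms(1,2)] const_mat_mult_carrier[OF assms(3,4)]])
  then show ?thesis
    by (simp add: mat_act_index[OF assms(1,2)] const_mat_mult_index[OF assms(3,4)]
        del: index_mult_mat)
qed

lemma row_act_cong_op:
  "(\<And>k. k < N \<Longrightarrow> D k j = D' k j') \<Longrightarrow> row_act N u D j = row_act N u D' j'"
  by (simp add: row_act_def)

lemma row_comb_cong_coeffs: "(\<And>a. a < N \<Longrightarrow> c a = c' a) \<Longrightarrow> row_comb N c R i = row_comb N c' R i"
  by (simp add: row_comb_def)

text \<open>The zero matrix has degree 0 by convention; for \<open>n > 0\<close> a degree equal to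
  \<open>n\<close> therefore really means a nonzero coefficient matrix at \<open>n\<close>.\<close>

lemma mat_degree_eq_iff:
  assumes "f \<in> carrier_mat N N" "0 < n"
  shows "mat_degree f = n \<longleftrightarrow> (\<forall>a<N. row_deg_less N (Suc n) (mat_rows f a)) \<and>
    (\<exists>a<N. \<exists>i<N. coeff (f $$ (a, i)) n \<noteq> 0)"
proof -
  obtain m where n: "n = Suc m" using assms(2) by (cases n) auto
  have "mat_degree f = n \<longleftrightarrow> mat_degree f \<le> n \<and> \<not> mat_degree f \<le> m"
    using n by auto
  also have "\<dots> \<longleftrightarrow> (\<forall>a<N. row_deg_less N (Suc n) (mat_rows f a)) \<and>
      \<not> (\<forall>a<N. row_deg_less N n (mat_rows f a))"
    unfolding mat_degree_le_iff[OF assms(1)] n by simp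
  also have "\<dots> \<longleftrightarrow> (\<forall>a<N. row_deg_less N (Suc n) (mat_rows f a)) \<and>
      (\<exists>a<N. \<exists>i<N. coeff (f $$ (a, i)) n \<noteq> 0)"
  proof -
    have "row_deg_less N n u \<longleftrightarrow> (\<forall>i<N. coeff (u i) n = 0)" if "row_deg_less N (Suc n) u" for u
    proof
      assume *: "\<forall>i<N. coeff (u i) n = 0"
      show "row_deg_less N n u"
        unfolding row_deg_less_def
      proof (intro allI impI)
        fix i k assume "i < N" "n \<le> k"
        then show "coeff (u i) k = 0"
          using that * by (cases "k = n") (auto simp: row_deg_less_def)
      qed
    qed (simp add: row_deg_less_def)
    then show ?thesis by blast
  qed
  finally show ?thesis .
qed

lemma degree_preserving_intertwiner:
  assumes "intertwiner N B P B' Q (op_entries E) G" "nonsingular N (G n0)"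
    and E: "E \<in> carrier_mat N N"
  shows "degree_preserving N E"
  unfolding degree_preserving_def
proof -
  interpret intertwiner N B P B' Q "op_entries E" G by fact
  \<comment> \<open>Degree 0, where the zero matrix interferes, joins the finitely many
    exceptions.\<close>
  have "\<forall>\<^sub>\<infinity>n::nat. 0 < n" unfolding cofinite_eq_sequentially by (rule eventually_gt_at_top)
  with eventually_preserves_degree[OF assms(2)]
  show "\<forall>\<^sub>\<infinity>n. \<forall>f\<in>carrier_mat N N. mat_degree f = n \<longrightarrow> mat_degree (mat_act f E) = n"
  proof (eventually_elim, intro ballI impI)
    fix n f
    assume lead: "\<forall>u. row_deg_less N (Suc n) u \<longrightarrow> (\<forall>j<N. coeff (row_act N u (op_entries E) j) n = 0) \<longrightarrow>
        (\<forall>i<N. coeff (u i) n = 0)"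
      and n: "0 < n" and f: "f \<in> carrier_mat N N" "mat_degree f = n"
    have fE: "mat_act f E $$ (a, j) = row_act N (mat_rows f a) (op_entries E) j" if "a < N" "j < N" for a j
      using mat_act_index[OF f(1) E that] .
    from f(2) have deg: "\<forall>a<N. row_deg_less N (Suc n) (mat_rows f a)"
      and "\<exists>a<N. \<exists>i<N. coeff (f $$ (a, i)) n \<noteq> 0"
      unfolding mat_degree_eq_iff[OF f(1) n] by blast+
    then obtain a i where a: "a < N" "i < N" "coeff (f $$ (a, i)) n \<noteq> 0" by blast
    show "mat_degree (mat_act f E) = n"
      unfolding mat_degree_eq_iff[OF mat_act_carrier[OF f(1) E] n]
    proof (intro conjI allI impI)
      fix b assume b: "b < N"
      have "row_deg_less N (Suc n) (row_act N (mat_rows f b) (op_entries E))"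
        using deg b by (intro row_deg_less_row_act) simp
      then show "row_deg_less N (Suc n) (mat_rows (mat_act f E) b)"
        using b by (simp add: row_deg_less_def fE)
    next
      have "\<exists>j<N. coeff (row_act N (mat_rows f a) (op_entries E) j) n \<noteq> 0"
        using lead[rule_format, of "mat_rows f a" i] deg a by blast
      then obtain j where "j < N" "coeff (row_act N (mat_rows f a) (op_entries E) j) n \<noteq> 0"
        by blast
      then show "\<exists>a<N. \<exists>i<N. coeff (mat_act f E $$ (a, i)) n \<noteq> 0"
        using a(1) by (intro exI[of _ a] exI[of _ j] conjI) (simp_all add: fE)
    qed
  qed
qed

text \<open>A nonzero \<open>c\<close> in the left kernel of \<open>G n\<close> gives a row of
  degree \<open>n\<close> that \<open>E\<close> sends to 0. For \<open>n > 0\<close> this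
  contradicts preservation of degree.\<close>

lemma nonsingular_if_degree_preserving:
  assumes "intertwiner N B P B' Q (op_entries E) G" "degree_preserving N E"
    and E: "E \<in> carrier_mat N N" and "0 < N"
  shows "\<exists>n. nonsingular N (G n)"
proof -
  interpret intertwiner N B P B' Q "op_entries E" G by fact
  have "\<forall>\<^sub>\<infinity>n::nat. 0 < n" unfolding cofinite_eq_sequentially by (rule eventually_gt_at_top)
  with assms(2)[unfolded degree_preserving_def]
  have "\<forall>\<^sub>\<infinity>n. 0 < n \<and> (\<forall>f\<in>carrier_mat N N. mat_degree f = n \<longrightarrow> mat_degree (mat_act f E) = n)"
    by eventually_elim simp
  from eventually_happens'[OF sequentially_bot this[unfolded cofinite_eq_sequentially]]
  obtain n where n: "0 < n"
    and dp: "\<And>f. f \<in> carrier_mat N N \<Longrightarrow> mat_degree f = n \<Longrightarrow> mat_degree (mat_act f E) = n"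
    by blast
  have "nonsingular N (G n)"
    unfolding nonsingular_def
  proof (intro allI impI, rule ccontr)
    fix c a assume c: "\<forall>b<N. (\<Sum>a<N. c a * G n a b) = 0" and a: "a < N" "c a \<noteq> 0"
    \<comment> \<open>Preservation of degree concerns square matrices, so the row is repeated
      \<open>N\<close> times.\<close>
    define f where "f = mat N N (\<lambda>(k :: nat, i). row_comb N c (P n) i)"
    have f: "f \<in> carrier_mat N N" by (simp add: f_def)
    have row: "mat_rows f k i = row_comb N c (P n) i" if "k < N" "i < N" for k i
      using that by (simp add: f_def)
    obtain i where i: "i < N" "(\<Sum>a<N. c a * coeff (P n a i) n) \<noteq> 0"
      using nonsingularD[OF P.lead[of n], of c a] a by auto
    have "mat_degree f = n"
      unfolding mat_degree_eq_iff[OF f n]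
    proof (intro conjI allI impI exI)
      show "row_deg_less N (Suc n) (mat_rows f k)" if "k < N" for k
        using P.row_deg_less_row_comb[of n c] that by (simp add: row_deg_less_def row)
      show "a < N" "i < N" "coeff (f $$ (a, i)) n \<noteq> 0"
        using a i by (simp_all add: row coeff_row_comb)
    qed
    then have "mat_degree (mat_act f E) = n" using f dp by blast
    then obtain k j where kj: "k < N" "j < N" "coeff (mat_act f E $$ (k, j)) n \<noteq> 0"
      unfolding mat_degree_eq_iff[OF mat_act_carrier[OF f E] n] by blast
    have "mat_act f E $$ (k, j) = row_act N (mat_rows f k) (op_entries E) j"
      using f E kj(1,2) by (rule mat_act_index)
    also have "row_act N (mat_rows f k) (op_entries E) = row_act N (row_comb N c (P n)) (op_entries E)"
      using row kj(1) by (intro row_act_cong)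
    also have "row_act N (row_comb N c (P n)) (op_entries E) j = 0"
      unfolding row_act_comb_P[OF kj(2)] using c by (intro row_comb_eq_0) simp
    finally show False using kj(3) by simp
  qed
  then show ?thesis by blast
qed

text \<open>Each row of \<open>Q n\<close> is orthogonal to \<open>P m\<close> for
  \<open>m < n\<close> since \<open>P m\<close> has lower degree, and for \<open>m > n\<close> since
  the row itself has lower degree than \<open>P m\<close>. So orthogonal sequences for one form
  differ by constant left factors.\<close>

lemma orth_rows_unique:
  assumes "orth_rows N B P" "orth_rows N B Q"
  shows "\<exists>C. \<forall>a<N. \<forall>i<N. Q n a i = row_comb N (C a) (P n) i"
proof -
  interpret P: orth_rows N B P by fact
  interpret Q: orth_rows N B Q by fact
  have "\<exists>c. \<forall>i<N. Q n a i = row_comb N c (P n) i" if a: "a < N" for a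
  proof (rule P.orth_complement)
    fix m b assume m: "m \<noteq> n" "b < N"
    show "B (Q n a) (P m b) = 0"
    proof (cases "m < n")
      case True
      then have "row_deg_less N n (P m b)" using P.deg[OF m(2), of m] by (auto simp: row_deg_less_def)
      then show ?thesis using Q.orth_lower(2) a by blast
    next
      case False
      then have "row_deg_less N m (Q n a)" using Q.deg[OF a, of n] m(1) by (auto simp: row_deg_less_def)
      then show ?thesis using P.orth_lower(1) m(2) by blast
    qed
  qed
  then have "\<forall>a. \<exists>c. a < N \<longrightarrow> (\<forall>i<N. Q n a i = row_comb N c (P n) i)" by blast
  from choice[OF this] show ?thesis by blast
qed

text \<open>Used to place a composition in \<open>op_algebra\<close>, which quantifies over all
  orthogonal sequences. The new sequence is expressed in the old one by \<open>C\<close> and back by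
  \<open>C'\<close>, so the constant matrix is \<open>C G H C'\<close>.\<close>

lemma intertwiner_round_trip:
  assumes "intertwiner N B P B' Q D G" "intertwiner N B' Q B P E H" "orth_rows N B P'"
  shows "\<exists>L. \<forall>a<N. \<forall>j<N. row_act N (row_act N (P' n a) D) E j = row_comb N (L a) (P' n) j"
proof -
  interpret D: intertwiner N B P B' Q D G by fact
  interpret E: intertwiner N B' Q B P E H by fact
  obtain C where C: "\<forall>a<N. \<forall>i<N. P' n a i = row_comb N (C a) (P n) i"
    using orth_rows_unique[OF D.P.orth_rows_axioms assms(3), of n] by (elim exE)
  obtain C' where C': "\<forall>a<N. \<forall>i<N. P n a i = row_comb N (C' a) (P' n) i"
    using orth_rows_unique[OF assms(3) D.P.orth_rows_axioms, of n] by (elim exE)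
  define K where "K a b = (\<Sum>l<N. (\<Sum>k<N. C a k * G n k l) * H n l b)" for a b
  have "row_act N (row_act N (P' n a) D) E j = row_comb N (\<lambda>k. \<Sum>b<N. K a b * C' b k) (P' n) j"
    if a: "a < N" and j: "j < N" for a j
  proof -
    have "row_act N (P' n a) D = row_act N (row_comb N (C a) (P n)) D"
      using C a by (intro row_act_cong) simp
    then have "row_act N (row_act N (P' n a) D) E
        = row_act N (row_comb N (\<lambda>l. \<Sum>k<N. C a k * G n k l) (Q n)) E"
      using D.row_act_comb_P by (intro row_act_cong) simp
    then have "row_act N (row_act N (P' n a) D) E j = row_comb N (K a) (P n) j"
      using E.row_act_comb_P[OF j] by (simp add: K_def[abs_def])
    also have "\<dots> = row_comb N (K a) (\<lambda>b. row_comb N (C' b) (P' n)) j"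
      using C' j by (intro row_comb_cong) simp
    finally show ?thesis unfolding row_comb_row_comb .
  qed
  then show ?thesis by (intro exI[of _ "\<lambda>a k. \<Sum>b<N. K a b * C' b k"] allI impI)
qed

section \<open>Intertwiners between a sequence and a direct sum\<close>

lemma row_comb_direct_sum:
  assumes p: "\<And>j. j \<in> {1..M} \<Longrightarrow> p j \<in> carrier_mat (d j) (d j)" and j: "j \<in> {1..M}" "b < d j"
  shows "row_comb (\<Sum>j=1..M. d j) c (mat_rows (mat_direct_sum M p)) (block_offset d j + b)
    = row_comb (d j) (\<lambda>b. c (block_offset d j + b)) (mat_rows (p j)) b"
proof -
  have "row_comb (\<Sum>j=1..M. d j) c (mat_rows (mat_direct_sum M p)) (block_offset d j + b)
    = (\<Sum>i=1..M. if i = j then row_comb (d j) (\<lambda>b. c (block_offset d j + b)) (mat_rows (p j)) b else 0)"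
    unfolding row_comb_def sum_blocks using mat_direct_sum_index[of M p d _ j _ b, OF p _ j(1) _ j(2)]
    by (intro sum.cong refl) (auto intro!: sum.neutral)
  then show ?thesis using j(1) by simp
qed

lemma direct_sum_intertwiner:
  assumes P: "orth_rows N B (\<lambda>n. mat_rows (P n))" "\<And>n. P n \<in> carrier_mat N N"
    and Q: "orth_rows N B' (\<lambda>n. mat_rows (mat_direct_sum M (\<lambda>j. p j n)))"
    and p: "\<And>j n. j \<in> {1..M} \<Longrightarrow> p j n \<in> carrier_mat (d j) (d j)"
    and N: "(\<Sum>j=1..M. d j) = N"
    and D: "\<And>j. j \<in> {1..M} \<Longrightarrow> D j \<in> carrier_mat N (d j)"
    and L: "\<And>j n. j \<in> {1..M} \<Longrightarrow> L j n \<in> carrier_mat N (d j)"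
    and eq: "\<And>j n. j \<in> {1..M} \<Longrightarrow> const_mat (L j n) * p j n = mat_act (P n) (D j)"
  shows "intertwiner N B (\<lambda>n. mat_rows (P n)) B' (\<lambda>n. mat_rows (mat_direct_sum M (\<lambda>j. p j n)))
    (op_entries (side_by_side N M D)) (\<lambda>n. mat_rows (side_by_side N M (\<lambda>j. L j n)))"
proof -
  interpret P: orth_rows N B "\<lambda>n. mat_rows (P n)" by fact
  interpret Q: orth_rows N B' "\<lambda>n. mat_rows (mat_direct_sum M (\<lambda>j. p j n))" by fact
  show ?thesis
  proof
    fix n a k assume a: "a < N" and "k < N"
    then have "k < (\<Sum>j=1..M. d j)" by (simp only: N)
    then obtain j b where j: "j \<in> {1..M}" "b < d j" "k = block_offset d j + b" by (rule block_cases)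
    have "row_act N (mat_rows (P n) a) (op_entries (side_by_side N M D)) k
      = row_act N (mat_rows (P n) a) (op_entries (D j)) b"
      unfolding j(3) using side_by_side_index[of M D N d, OF _ j(1) _ j(2)] D
      by (intro row_act_cong_op) simp
    also have "\<dots> = row_comb (d j) (mat_rows (L j n) a) (mat_rows (p j n)) b"
      using eq[OF j(1), of n, symmetric] a j(2)
      unfolding mat_act_eq_iff[OF P(2) D[OF j(1)] L[OF j(1)] p[OF j(1)]] by blast
    also have "\<dots> = row_comb (d j) (\<lambda>b. side_by_side N M (\<lambda>j. L j n) $$ (a, block_offset d j + b)) (mat_rows (p j n)) b"
      using side_by_side_index[of M "\<lambda>j. L j n" N d, OF _ j(1) a] L
      by (intro row_comb_cong_coeffs) simp
    also have "\<dots> = row_comb N (mat_rows (side_by_side N M (\<lambda>j. L j n)) a) (mat_rows (mat_direct_sum M (\<lambda>j. p j n))) k"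
      unfolding j(3) N[symmetric]
      using row_comb_direct_sum[of M "\<lambda>j. p j n" d j b, OF p j(1,2), symmetric] .
    finally show "row_act N (mat_rows (P n) a) (op_entries (side_by_side N M D)) k
      = row_comb N (mat_rows (side_by_side N M (\<lambda>j. L j n)) a) (mat_rows (mat_direct_sum M (\<lambda>j. p j n))) k" .
  qed
qed

lemma intertwiner_of_mat_act:
  assumes "orth_rows N B (\<lambda>n. mat_rows (P n))" "orth_rows N B' (\<lambda>n. mat_rows (Q n))"
    and "\<And>n. P n \<in> carrier_mat N N" "\<And>n. Q n \<in> carrier_mat N N" "E \<in> carrier_mat N N"
    and A: "\<And>n. A n \<in> carrier_mat N N" "\<And>n. mat_act (P n) E = const_mat (A n) * Q n"
  shows "intertwiner N B (\<lambda>n. mat_rows (P n)) B' (\<lambda>n. mat_rows (Q n)) (op_entries E) (\<lambda>n. mat_rows (A n))"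
proof -
  interpret P: orth_rows N B "\<lambda>n. mat_rows (P n)" by fact
  interpret Q: orth_rows N B' "\<lambda>n. mat_rows (Q n)" by fact
  show ?thesis
  proof
    fix n a j assume "a < N" "j < N"
    then show "row_act N (mat_rows (P n) a) (op_entries E) j = row_comb N (mat_rows (A n) a) (mat_rows (Q n)) j"
      using A(2)[of n] unfolding mat_act_eq_iff[OF assms(3,5) A(1) assms(4)] by blast
  qed
qed

lemma intertwiner_mat:
  assumes "intertwiner N B P B' Q V A"
  shows "intertwiner N B P B' Q (op_entries (mat N N (\<lambda>(k, j). Weyl (V k j)))) A"
proof -
  interpret intertwiner N B P B' Q V A by fact
  show ?thesis
  proof
    fix n a j assume "a < N" "j < N"
    moreover from this have "row_act N (P n a) (op_entries (mat N N (\<lambda>(k, j). Weyl (V k j)))) j = row_act N (P n a) V j"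
      by (intro row_act_cong_op) simp
    ultimately show "row_act N (P n a) (op_entries (mat N N (\<lambda>(k, j). Weyl (V k j)))) j = row_comb N (A n a) (Q n) j"
      using intertwines by simp
  qed
qed

theorem theorem5p1:
  fixes x0 x1 :: ereal and N M :: nat and d :: "nat \<Rightarrow> nat"
    and W :: "real \<Rightarrow> complex mat" and P :: "nat \<Rightarrow> complex poly mat"
    and w :: "nat \<Rightarrow> real \<Rightarrow> complex mat" and p :: "nat \<Rightarrow> nat \<Rightarrow> complex poly mat"
  assumes "x0 < x1"
    and "weight_matrix x0 x1 N W"
    and "orthogonal_polys x0 x1 N W P"
    and "\<And>j. j \<in> {1..M} \<Longrightarrow> weight_matrix x0 x1 (d j) (w j)"
    and "\<And>j. j \<in> {1..M} \<Longrightarrow> orthogonal_polys x0 x1 (d j) (w j) (p j)"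
    and "(\<Sum>j=1..M. d j) = N"
    and "good_weight x0 x1 N W"
    and "\<And>j. j \<in> {1..M} \<Longrightarrow> good_weight x0 x1 (d j) (w j)"
    and "good_weight x0 x1 N (\<lambda>x. mat_direct_sum M (\<lambda>j. w j x))"
  shows "darboux_transformation x0 x1 N
           (\<lambda>x. mat_direct_sum M (\<lambda>j. w j x)) (\<lambda>n. mat_direct_sum M (\<lambda>j. p j n)) P \<longleftrightarrow>
         (\<exists>(D :: nat \<Rightarrow> weyl mat) (\<Lambda> :: nat \<Rightarrow> nat \<Rightarrow> complex mat).
            (\<forall>j\<in>{1..M}. D j \<in> carrier_mat N (d j) \<and>
               (\<forall>n. \<Lambda> j n \<in> carrier_mat N (d j) \<and>
                    const_mat (\<Lambda> j n) * p j n = mat_act (P n) (D j))) \<and>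
            (\<exists>n. invertible_mat (side_by_side N M (\<lambda>j. \<Lambda> j n))))"
    (is "?darboux \<longleftrightarrow> ?ops")
proof -
  define w' where "w' x = mat_direct_sum M (\<lambda>j. w j x)" for x
  define q where "q n = mat_direct_sum M (\<lambda>j. p j n)" for n
  define B where "B = row_integral x0 x1 N W"
  define B' where "B' = row_integral x0 x1 N w'"
  note N = assms(6)
  have P: "P n \<in> carrier_mat N N" for n using assms(3) by (simp add: orthogonal_polys_def)
  have p: "p j n \<in> carrier_mat (d j) (d j)" if "j \<in> {1..M}" for j n
    using assms(5)[OF that] by (simp add: orthogonal_polys_def)
  have q: "q n \<in> carrier_mat N N" for n
    unfolding q_def N[symmetric] by (rule mat_direct_sum_carrier) (rule p)
  have w: "w j x \<in> carrier_mat (d j) (d j)" if "j \<in> {1..M}" "x \<in> einterval x0 x1" for j x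
    using assms(4)[OF that(1)] that(2) by (simp add: weight_matrix_def)
  have w': "w' x \<in> carrier_mat N N" if "x \<in> einterval x0 x1" for x
    unfolding w'_def N[symmetric] by (rule mat_direct_sum_carrier) (rule w[OF _ that])
  have fm: "finite_moments x0 x1 (d j) (w j)" if "j \<in> {1..M}" for j
    using assms(4)[OF that] by (simp add: weight_matrix_def finite_moments_def)
  have fm': "finite_moments x0 x1 N w'"
    unfolding w'_def[abs_def] N[symmetric] by (rule finite_moments_direct_sum) (rule fm, assumption, rule w)
  have orthP: "orth_rows N B (\<lambda>n. mat_rows (P n))"
    unfolding B_def
  proof (rule orth_rows_orthogonal_polys[OF row_form_weight[OF assms(1,2)] assms(3)])
    show "finite_moments x0 x1 N W" "\<And>x. x \<in> einterval x0 x1 \<Longrightarrow> W x \<in> carrier_mat N N"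
      using assms(2) by (simp_all add: weight_matrix_def finite_moments_def)
  qed
  have orthp: "orth_rows (d j) (row_integral x0 x1 (d j) (w j)) (\<lambda>n. mat_rows (p j n))" if "j \<in> {1..M}" for j
    using row_form_weight[OF assms(1) assms(4)[OF that]] assms(5)[OF that] fm[OF that] w[OF that]
    by (rule orth_rows_orthogonal_polys)
  \<comment> \<open>The form of the direct sum weight is the sum of the block forms, so
    orthogonality of \<open>q\<close> can be checked block by block.\<close>
  have B': "B' = (\<lambda>u v. \<Sum>j=1..M. row_integral x0 x1 (d j) (w j) (row_block d j u) (row_block d j v))"
    unfolding B'_def w'_def[abs_def] N[symmetric]
    by (intro ext row_integral_direct_sum) (rule w)
  have orthq: "orth_rows N B' (\<lambda>n. mat_rows (q n))"
    unfolding B' N[symmetric]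
  proof (rule orth_rows_blocks)
    show "orth_rows (d j) (row_integral x0 x1 (d j) (w j)) (\<lambda>n. mat_rows (p j n))" if "j \<in> {1..M}" for j
      using that by (rule orthp)
    show "q n $$ (block_offset d i + a, block_offset d j + b) = (if i = j then p i n $$ (a, b) else 0)"
      if "i \<in> {1..M}" "j \<in> {1..M}" "a < d i" "b < d j" for n i j a b
      unfolding q_def using p that by (rule mat_direct_sum_index)
  qed
  have N_pos: "0 < N" using assms(2) by (simp add: weight_matrix_def)
  have darboux: "?darboux \<longleftrightarrow> darboux_transformation x0 x1 N w' q P"
    by (simp add: w'_def[abs_def] q_def[abs_def])
  show ?thesis
    unfolding darboux
  proof
    assume "darboux_transformation x0 x1 N w' q P"
    then obtain V where V: "V \<in> carrier_mat N N" "degree_preserving N V"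
      and "\<forall>n. \<exists>A\<in>carrier_mat N N. mat_act (q n) V = const_mat A * P n"
      unfolding darboux_transformation_def by blast
    then obtain A where A: "\<And>n. A n \<in> carrier_mat N N" "\<And>n. mat_act (q n) V = const_mat (A n) * P n"
      by metis
    interpret V: intertwiner N B' "\<lambda>n. mat_rows (q n)" B "\<lambda>n. mat_rows (P n)" "op_entries V" "\<lambda>n. mat_rows (A n)"
      using orthq orthP q P V(1) A by (rule intertwiner_of_mat_act)
    \<comment> \<open>Preservation of degree by \<open>V\<close> forces some \<open>A n0\<close> to
      be nonsingular.\<close>
    obtain n0 where n0: "nonsingular N (mat_rows (A n0))"
      using nonsingular_if_degree_preserving[OF V.intertwiner_axioms V(2,1) N_pos] by blast
    \<comment> \<open>The adjoint of \<open>V\<close> runs in the required direction, from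
      \<open>P n\<close> to the direct sum.\<close>
    obtain E G where E: "intertwiner N B (\<lambda>n. mat_rows (P n)) B' (\<lambda>n. mat_rows (q n)) E G"
      and G: "\<And>n. nonsingular N (mat_rows (A n)) \<Longrightarrow> nonsingular N (G n)"
      by (rule V.adjoint_intertwiner) blast
    \<comment> \<open>The columns of the adjoint, and of its matrices \<open>G n\<close>, are cut
      into blocks of width \<open>d j\<close>.\<close>
    define D where "D j = mat N (d j) (\<lambda>(k, b). Weyl (E k (block_offset d j + b)))" for j
    define L where "L j n = mat N (d j) (\<lambda>(a, b). G n a (block_offset d j + b))" for j n
    have DL: "D j \<in> carrier_mat N (d j)" "L j n \<in> carrier_mat N (d j)" for j n
      by (simp_all add: D_def L_def)
    have "mat_act (P n) (D j) = const_mat (L j n) * p j n" if j: "j \<in> {1..M}" for j n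
      unfolding mat_act_eq_iff[OF P DL p[OF j]]
    proof (intro allI impI)
      fix a b assume a: "a < N" and b: "b < d j"
      have off: "block_offset d j + b < N" using block_offset_less[of j M b d, OF j b] N by simp
      have "row_act N (mat_rows (P n) a) (op_entries (D j)) b = row_act N (mat_rows (P n) a) E (block_offset d j + b)"
        using b by (intro row_act_cong_op) (simp add: D_def)
      also have "\<dots> = row_comb N (G n a) (mat_rows (q n)) (block_offset d j + b)"
        using a off by (rule intertwiner.intertwines[OF E])
      also have "\<dots> = row_comb (d j) (\<lambda>b. G n a (block_offset d j + b)) (mat_rows (p j n)) b"
        unfolding q_def N[symmetric] using p j b by (rule row_comb_direct_sum)
      also have "\<dots> = row_comb (d j) (mat_rows (L j n) a) (mat_rows (p j n)) b"
        using a by (intro row_comb_cong_coeffs) (simp add: L_def)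
      finally show "row_act N (mat_rows (P n) a) (op_entries (D j)) b = row_comb (d j) (mat_rows (L j n) a) (mat_rows (p j n)) b" .
    qed
    moreover have "invertible_mat (side_by_side N M (\<lambda>j. L j n0))"
    proof -
      have S: "side_by_side N M (\<lambda>j. L j n0) \<in> carrier_mat N N"
        using side_by_side_carrier[of M "\<lambda>j. L j n0" N d] DL(2) N by simp
      have "side_by_side N M (\<lambda>j. L j n0) $$ (a, k) = G n0 a k" if a: "a < N" and k: "k < N" for a k
      proof -
        from k have "k < (\<Sum>j=1..M. d j)" by (simp only: N)
        then obtain j b where j: "j \<in> {1..M}" "b < d j" "k = block_offset d j + b" by (rule block_cases)
        show ?thesis
          unfolding j(3) side_by_side_index[of M "\<lambda>j. L j n0" N d j a b, OF DL(2) j(1) a j(2)]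
          using a j(2) by (simp add: L_def)
      qed
      then have "nonsingular N (mat_rows (side_by_side N M (\<lambda>j. L j n0))) \<longleftrightarrow> nonsingular N (G n0)"
        by (rule nonsingular_cong)
      then show ?thesis
        unfolding invertible_mat_nonsingular[OF S] using G[OF n0] by simp
    qed
    ultimately show ?ops
      using DL by (intro exI[of _ D] exI[of _ L]) auto
  next
    assume ?ops
    then obtain D L n0 where D: "\<And>j. j \<in> {1..M} \<Longrightarrow> D j \<in> carrier_mat N (d j)"
      and L: "\<And>j n. j \<in> {1..M} \<Longrightarrow> L j n \<in> carrier_mat N (d j)"
      and eq: "\<And>j n. j \<in> {1..M} \<Longrightarrow> const_mat (L j n) * p j n = mat_act (P n) (D j)"
      and inv: "invertible_mat (side_by_side N M (\<lambda>j. L j n0))"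
      by blast
    let ?E = "side_by_side N M D" and ?G = "\<lambda>n. side_by_side N M (\<lambda>j. L j n)"
    have E: "?E \<in> carrier_mat N N"
      using side_by_side_carrier[of M D N d, OF D] N by simp
    have "?G n0 \<in> carrier_mat N N"
      using side_by_side_carrier[of M "\<lambda>j. L j n0" N d, OF L] N by simp
    then have n0: "nonsingular N (mat_rows (?G n0))"
      using inv invertible_mat_nonsingular by blast
    \<comment> \<open>The \<open>D j\<close> side by side form the second factor of the Darboux
      factorization; its adjoint \<open>V\<close> will be the first.\<close>
    interpret E: intertwiner N B "\<lambda>n. mat_rows (P n)" B' "\<lambda>n. mat_rows (q n)" "op_entries ?E" "\<lambda>n. mat_rows (?G n)"
      using orthP P orthq p N D L eq unfolding q_def by (rule direct_sum_intertwiner)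
    obtain V0 A where V0: "intertwiner N B' (\<lambda>n. mat_rows (q n)) B (\<lambda>n. mat_rows (P n)) V0 A"
      and A: "\<And>n. nonsingular N (mat_rows (?G n)) \<Longrightarrow> nonsingular N (A n)"
      by (rule E.adjoint_intertwiner) blast
    define V where "V = mat N N (\<lambda>(k, j). Weyl (V0 k j))"
    have V: "V \<in> carrier_mat N N" by (simp add: V_def)
    interpret V: intertwiner N B' "\<lambda>n. mat_rows (q n)" B "\<lambda>n. mat_rows (P n)" "op_entries V" A
      unfolding V_def using V0 by (rule intertwiner_mat)
    \<comment> \<open>Going to \<open>P n\<close> and back multiplies \<open>q n\<close> by a
      constant matrix on the left; the round trip lemma transports this to an arbitrary orthogonal
      sequence \<open>Q\<close>.\<close>
    have "V * ?E \<in> op_algebra x0 x1 N w'"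
      unfolding op_algebra_def
    proof (intro CollectI conjI allI impI)
      show "V * ?E \<in> carrier_mat N N" using V E by simp
      fix Q n assume Q: "orthogonal_polys x0 x1 N w' Q"
      have Qn: "Q n \<in> carrier_mat N N" using Q by (simp add: orthogonal_polys_def)
      have "orth_rows N B' (\<lambda>n. mat_rows (Q n))"
        unfolding B'_def
        \<comment> \<open>That \<open>B'\<close> is a definite form comes from its description as a
          sum of block forms.\<close>
        by (rule orth_rows_orthogonal_polys[OF _ Q fm' w'])
          (use orth_rows.axioms(1)[OF orthq] in \<open>simp add: B'_def\<close>)
      from intertwiner_round_trip[OF V.intertwiner_axioms E.intertwiner_axioms this, of n]
      obtain c where c: "\<And>a j. a < N \<Longrightarrow> j < N \<Longrightarrow>
          row_act N (row_act N (mat_rows (Q n) a) (op_entries V)) (op_entries ?E) j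
            = row_comb N (c a) (mat_rows (Q n)) j"
        by blast
      define C where "C = mat N N (\<lambda>(a, b). c a b)"
      have C: "C \<in> carrier_mat N N" by (simp add: C_def)
      have "mat_act (mat_act (Q n) V) ?E = const_mat C * Q n"
        unfolding mat_act_eq_iff[OF mat_act_carrier[OF Qn V] E C Qn]
      proof (intro allI impI)
        fix a j assume a: "a < N" and j: "j < N"
        have "row_act N (mat_rows (mat_act (Q n) V) a) (op_entries ?E) j
            = row_act N (row_act N (mat_rows (Q n) a) (op_entries V)) (op_entries ?E) j"
          using a by (intro fun_cong[OF row_act_cong]) (simp add: mat_act_index[OF Qn V])
        also have "\<dots> = row_comb N (c a) (mat_rows (Q n)) j" using a j by (rule c)
        also have "\<dots> = row_comb N (mat_rows C a) (mat_rows (Q n)) j"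
          using a by (intro row_comb_cong_coeffs) (simp add: C_def)
        finally show "row_act N (mat_rows (mat_act (Q n) V) a) (op_entries ?E) j
            = row_comb N (mat_rows C a) (mat_rows (Q n)) j" .
      qed
      then show "\<exists>\<Lambda>\<in>carrier_mat N N. mat_act (Q n) (V * ?E) = const_mat \<Lambda> * Q n"
        using C mat_act_mult[OF Qn V E] by auto
    qed
    moreover have "\<exists>C\<in>carrier_mat N N. mat_act (q n) V = const_mat C * P n" for n
    proof
      show C: "mat N N (\<lambda>(a, b). A n a b) \<in> carrier_mat N N" by simp
      show "mat_act (q n) V = const_mat (mat N N (\<lambda>(a, b). A n a b)) * P n"
        unfolding mat_act_eq_iff[OF q V C P]
      proof (intro allI impI)
        fix a j assume a: "a < N" and j: "j < N"
        have "row_act N (mat_rows (q n) a) (op_entries V) j = row_comb N (A n a) (mat_rows (P n)) j"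
          using a j by (rule V.intertwines)
        also have "\<dots> = row_comb N (mat_rows (mat N N (\<lambda>(a, b). A n a b)) a) (mat_rows (P n)) j"
          using a by (intro row_comb_cong_coeffs) simp
        finally show "row_act N (mat_rows (q n) a) (op_entries V) j
            = row_comb N (mat_rows (mat N N (\<lambda>(a, b). A n a b)) a) (mat_rows (P n)) j" .
      qed
    qed
    \<comment> \<open>Adjunction keeps nonsingularity at \<open>n0\<close>, and one such index
      suffices for preservation of degree.\<close>
    moreover have "degree_preserving N V"
      using V.intertwiner_axioms A[OF n0] V by (rule degree_preserving_intertwiner)
    moreover have "degree_preserving N ?E"
      using E.intertwiner_axioms n0 E by (rule degree_preserving_intertwiner)
    ultimately show "darboux_transformation x0 x1 N w' q P"
      unfolding darboux_transformation_def
      by (intro bexI[of _ "V * ?E"] bexI[of _ V] bexI[of _ ?E] conjI allI refl V E)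
  qed
qed

end
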